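(* Let $(D,p)$ be an oriented based link diagram with mirror image $(\overline{D},\overline{p})$. There is an isomorphism $\widetilde{CKh}(D,p)\cong\widetilde{CKh}(\overline{D},\overline{p})^!$ of chain complexes of graded $R$-modules.
   Context: Fix a field $\mathbb{F}$. Let $R=\mathbb{F}[U,V]$, graded with $U,V$ in grading $-2$, and $A=R[X]/((X-U)(X-V))$, a Frobenius algebra over $R$ with trace $\varepsilon:A\to R$, $\varepsilon(1)=0$, $\varepsilon(X)=1$, and comultiplication $\Delta(1)=X\otimes 1+1\otimes X-(U+V)1\otimes 1$, $\Delta(X)=X\otimes X-UV\,1\otimes 1$ (tensor products over $R$). Let $\mathcal{F}$ be the associated $(1+1)$-dimensional TQFT: $k$ disjoint circles in the plane are sent to $A^{\otimes k}$; merge saddles act by multiplication, split saddles by $\Delta$, births by the unit, deaths by $\varepsilon$. The grading $\operatorname{gr}$ on $A^{\otimes k}$ is additive over tensor factors with $\operatorname{gr}(1)=1$, $\operatorname{gr}(X)=-1$, and multiplication by $U$ or $V$ lowers it by $2$. Chain complex. Let $D$ be a diagram of an oriented link with crossings numbered $1,\dots,n$, of which $n_+$ are positive and $n_-$ negative. For $u\in\{0,1\}^n$ let $D_u$ be the collection of circles obtained by performing the $u_i$-smoothing at the $i$-th crossing (for a crossing drawn with over-strand running from bottom left to top right, the $0$-smoothing is the pair of vertical arcs $)($ and the $1$-smoothing is the pair of horizontal arcs). Put $|u|=\sum_i u_i$. Then $CKh(D)=\bigoplus_u \mathcal{F}(D_u)$ with $\mathcal{F}(D_u)$ in homological grading $|u|-n_-$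 and with quantum grading $\operatorname{gr}_q=\operatorname{gr}+|u|+n_+-2n_-$ on $\mathcal{F}(D_u)$; the differential is the sum, over edges $u\to v$ of the cube (one entry changed from $0$ to $1$), of $\pm\mathcal{F}$ of the saddle cobordism $D_u\to D_v$, with signs making every square anticommute. Reduced complex. For a diagram $D$ with a basepoint $p$ away from the crossings, let $f_p$ be the endomorphism of $CKh(D)$ which on each $\mathcal{F}(D_u)$ multiplies by $X-U$ the tensor factor of the circle containing $p$ and is the identity on all other factors. Then $\widetilde{CKh}(D,p)=\operatorname{im}(f_p)\{1\}$, where $\{1\}$ is an upward shift of the quantum grading by $1$. $\overline{D}$ is the mirror image diagram of $D$ (all crossings switched), and $\overline{p}$ is the image of $p$ in it. For a complex $C$ of finitely generated free graded $R$-modules, $C^!$ is the complex with $(C^{-i})^*=\operatorname{Hom}_R(C^{-i},R)$ in homological grading $i$ and differential dual to that of $C$; a map $C^{-i}\to R$ of degree $j$ has quantum grading $j$ (so the dual of a homogeneous basis element of grading $j$ has grading $-j$). *)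

theory Defs
  imports "HOL-Computational_Algebra.Polynomial"
begin

section \<open>Oriented link diagrams\<close>

text \<open>
  A diagram is given by an oriented planar diagram code. The arcs are the edges of the underlying
  4-valent plane graph, together with one arc for every component without crossings; such an arc
  is incident to no crossing.

  In \<open>Crossing \<sigma> a b c d\<close> the arcs are listed counterclockwise around the crossing, starting with
  the incoming end \<open>a\<close> of the under-strand, which therefore runs from \<open>a\<close> to \<open>c\<close>. The over-strand
  runs from \<open>d\<close> to \<open>b\<close> at a positive crossing and from \<open>b\<close> to \<open>d\<close> at a negative one.
\<close>

datatype crossing_sign = Pos | Neg

datatype 'e crossing = Crossing (csign: crossing_sign) 'e 'e 'e 'e

record 'e diagram =
  arcs :: "'e set"
  crossings :: "'e crossing list"

definition n_cross :: "'e diagram \<Rightarrow> nat" where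
  "n_cross D = length (crossings D)"

definition n_pos :: "'e diagram \<Rightarrow> nat" where
  "n_pos D = length (filter (\<lambda>c. csign c = Pos) (crossings D))"

definition n_neg :: "'e diagram \<Rightarrow> nat" where
  "n_neg D = length (filter (\<lambda>c. csign c = Neg) (crossings D))"

fun slot :: "'e crossing \<Rightarrow> nat \<Rightarrow> 'e" where
  "slot (Crossing \<sigma> a b c d) k = [a, b, c, d] ! k"

fun in_slots :: "crossing_sign \<Rightarrow> nat set" where
  "in_slots Pos = {0, 3}"
| "in_slots Neg = {0, 1}"

definition half_edges :: "'e diagram \<Rightarrow> (nat \<times> nat) set" where
  "half_edges D = {..<n_cross D} \<times> {..<4}"

definition label :: "'e diagram \<Rightarrow> nat \<times> nat \<Rightarrow> 'e" where
  "label D h = slot (crossings D ! fst h) (snd h)"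

definition incoming :: "'e diagram \<Rightarrow> (nat \<times> nat) set" where
  "incoming D = {h \<in> half_edges D. snd h \<in> in_slots (csign (crossings D ! fst h))}"

definition outgoing :: "'e diagram \<Rightarrow> (nat \<times> nat) set" where
  "outgoing D = half_edges D - incoming D"

definition equiv_closure :: "('a \<times> 'a) set \<Rightarrow> ('a \<times> 'a) set" where
  "equiv_closure r = (r \<union> r\<inverse>)\<^sup>*"

text \<open>
  Connected components of the underlying 4-valent graph, as classes of half-edges.
\<close>

definition graph_components :: "'e diagram \<Rightarrow> (nat \<times> nat) set set" where
  "graph_components D = half_edges D //
     equiv_closure {(h, h'). h \<in> half_edges D \<and> h' \<in> half_edges D \<and>
                             (fst h = fst h' \<or> label D h = label D h')}"

text \<open>
  Here \<open>(i, k)\<close> stands for the corner at crossing \<open>i\<close> between the slots \<open>k\<close> and \<open>k + 1\<close> (modulo 4).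
  If the slots \<open>(i, k)\<close> and \<open>(j, l)\<close> are the two ends of an arc, then the corner \<open>(i, k)\<close> lies on
  the same side of this arc as the corner \<open>(j, l - 1)\<close>. The faces of the surface obtained by
  gluing discs to the ribbon graph of the diagram are the resulting classes of corners.
\<close>

definition faces :: "'e diagram \<Rightarrow> (nat \<times> nat) set set" where
  "faces D = half_edges D //
     equiv_closure {((i, k), (j, (l + 3) mod 4)) | i k j l.
        (i, k) \<in> half_edges D \<and> (j, l) \<in> half_edges D \<and> (i, k) \<noteq> (j, l) \<and>
        label D (i, k) = label D (j, l)}"

text \<open>
  Planarity: every component has Euler characteristic 2. There are \<open>n\<close> vertices and \<open>2n\<close> edges, and
  no component contributes more than 2, so it is enough to sum over the components.
\<close>

definition planar :: "'e diagram \<Rightarrow> bool" where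
  "planar D \<longleftrightarrow>
     int (n_cross D) - 2 * int (n_cross D) + int (card (faces D)) = 2 * int (card (graph_components D))"

text \<open>
  Each arc meeting a crossing starts at exactly one outgoing slot and ends at exactly one incoming
  slot. Neither the position of the connected components of the diagram relative to each other nor
  the orientation of components without crossings is recorded: the complex does not depend on them.
\<close>

definition link_diagram :: "'e diagram \<Rightarrow> bool" where
  "link_diagram D \<longleftrightarrow>
     finite (arcs D) \<and> label D ` half_edges D \<subseteq> arcs D \<and>
     inj_on (label D) (incoming D) \<and> inj_on (label D) (outgoing D) \<and>
     label D ` incoming D = label D ` outgoing D \<and>
     planar D"

fun mirror_crossing :: "'e crossing \<Rightarrow> 'e crossing" where
  "mirror_crossing (Crossing Pos a b c d) = Crossing Neg d a b c"
| "mirror_crossing (Crossing Neg a b c d) = Crossing Pos b c d a"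

definition mirror :: "'e diagram \<Rightarrow> 'e diagram" where
  "mirror D = \<lparr>arcs = arcs D, crossings = map mirror_crossing (crossings D)\<rparr>"

section \<open>Smoothings\<close>

text \<open>
  A vertex \<open>u\<close> of the cube is encoded by the set \<open>I\<close> of crossings \<open>i\<close> with \<open>u\<^sub>i = 1\<close>, and a circle of
  \<open>D\<^sub>u\<close> by the set of arcs it consists of.

  The slots \<open>b\<close> and \<open>d\<close> are the ends of the over-strand. If it is drawn from bottom left (\<open>d\<close>) to
  top right (\<open>b\<close>), then \<open>a\<close> is at the bottom right and \<open>c\<close> at the top left, so that the vertical
  arcs join \<open>a\<close> with \<open>b\<close> and \<open>c\<close> with \<open>d\<close>.
\<close>

fun smoothing :: "bool \<Rightarrow> 'e crossing \<Rightarrow> ('e \<times> 'e) set" where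
  "smoothing False (Crossing \<sigma> a b c d) = {(a, b), (c, d)}"
| "smoothing True (Crossing \<sigma> a b c d) = {(a, d), (b, c)}"

definition circles :: "'e diagram \<Rightarrow> nat set \<Rightarrow> 'e set set" where
  "circles D I =
     arcs D // equiv_closure (\<Union>i<n_cross D. smoothing (i \<in> I) (crossings D ! i))"

definition circle_at :: "'e diagram \<Rightarrow> nat set \<Rightarrow> 'e \<Rightarrow> 'e set" where
  "circle_at D I p = (THE c. c \<in> circles D I \<and> p \<in> c)"

section \<open>The ground ring and the Frobenius algebra\<close>

text \<open>The ring \<open>\<bbbF>[U,V]\<close> is realized as \<open>\<bbbF>[U][V]\<close>.\<close>

type_synonym 'f UV = "'f poly poly"

definition U :: "'f::field UV" where
  "U = [:[:0, 1:]:]"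

definition V :: "'f::field UV" where
  "V = [:0, 1:]"

definition homog_UV :: "int \<Rightarrow> 'f::field UV set" where
  "homog_UV d = {r. \<forall>a b. coeff (coeff r b) a \<noteq> 0 \<longrightarrow> d = - 2 * (int a + int b)}"

text \<open>
  The algebra \<open>A\<close> has the \<open>R\<close>-basis \<open>1, X\<close>, indexed by \<open>False, True\<close>: \<open>mult_coeff a b c\<close> is the
  coefficient of \<open>c\<close> in the product of \<open>a\<close> and \<open>b\<close>, and \<open>comult_coeff a b c\<close> is the coefficient of
  \<open>b \<otimes> c\<close> in \<open>\<Delta>(a)\<close>.
\<close>

fun mult_coeff :: "bool \<Rightarrow> bool \<Rightarrow> bool \<Rightarrow> 'f::field UV" where
  "mult_coeff False b c = (if b = c then 1 else 0)"
| "mult_coeff True False c = (if c then 1 else 0)"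
| "mult_coeff True True c = (if c then U + V else - (U * V))"

fun comult_coeff :: "bool \<Rightarrow> bool \<Rightarrow> bool \<Rightarrow> 'f::field UV" where
  "comult_coeff False b c = (if b \<and> c then 0 else if b \<or> c then 1 else - (U + V))"
| "comult_coeff True b c = (if b \<and> c then 1 else if b \<or> c then 0 else - (U * V))"

definition A_basis :: "bool \<Rightarrow> 'f::field UV poly" where
  "A_basis b = (if b then [:0, 1:] else 1)"

text \<open>The structure constants are those of \<open>R[X]/((X-U)(X-V))\<close>.\<close>

lemma mult_coeff_quotient:
  "[:- U, 1:] * [:- V, 1:] dvd
     A_basis a * A_basis b - (\<Sum>c\<in>UNIV. smult (mult_coeff a b c) (A_basis c :: 'f::field UV poly))"
proof (cases "a \<and> b")
  case True
  then have "A_basis a * A_basis b - (\<Sum>c\<in>UNIV. smult (mult_coeff a b c) (A_basis c))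
      = [:- U, 1:] * [:- V, 1 :: 'f UV:]"
    by (simp add: A_basis_def UNIV_bool algebra_simps)
  then show ?thesis by simp
next
  case False
  then have "A_basis a * A_basis b - (\<Sum>c\<in>UNIV. smult (mult_coeff a b c) (A_basis c)) = (0 :: 'f UV poly)"
    by (cases a; cases b) (simp_all add: A_basis_def UNIV_bool)
  then show ?thesis by simp
qed

section \<open>Complexes of graded modules\<close>

text \<open>
  All modules are submodules of modules of functions \<open>'k \<Rightarrow> R\<close>, with pointwise operations.
  \<open>homog C i q\<close> consists of the homogeneous elements of quantum grading \<open>q\<close> in \<open>chain C i\<close>.
\<close>

record ('k, 'r) graded_complex =
  chain :: "int \<Rightarrow> ('k \<Rightarrow> 'r) set"
  homog :: "int \<Rightarrow> int \<Rightarrow> ('k \<Rightarrow> 'r) set"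
  dif :: "int \<Rightarrow> ('k \<Rightarrow> 'r) \<Rightarrow> ('k \<Rightarrow> 'r)"

definition linear_to_ring :: "('k \<Rightarrow> 'f::field UV) set \<Rightarrow> (('k \<Rightarrow> 'f UV) \<Rightarrow> 'f UV) \<Rightarrow> bool" where
  "linear_to_ring M f \<longleftrightarrow>
     (\<forall>x\<in>M. \<forall>y\<in>M. f (\<lambda>k. x k + y k) = f x + f y) \<and>
     (\<forall>r. \<forall>x\<in>M. f (\<lambda>k. r * x k) = r * f x)"

definition linear_between :: "('k \<Rightarrow> 'f::field UV) set \<Rightarrow> (('k \<Rightarrow> 'f UV) \<Rightarrow> ('l \<Rightarrow> 'f UV)) \<Rightarrow> bool" where
  "linear_between M f \<longleftrightarrow>
     (\<forall>x\<in>M. \<forall>y\<in>M. f (\<lambda>k. x k + y k) = (\<lambda>l. f x l + f y l)) \<and>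
     (\<forall>r. \<forall>x\<in>M. f (\<lambda>k. r * x k) = (\<lambda>l. r * f x l))"

definition isomorphic_complexes ::
    "('k, 'f::field UV) graded_complex \<Rightarrow> ('l, 'f UV) graded_complex \<Rightarrow> bool" where
  "isomorphic_complexes C C' \<longleftrightarrow>
     (\<exists>\<phi> :: int \<Rightarrow> ('k \<Rightarrow> 'f UV) \<Rightarrow> ('l \<Rightarrow> 'f UV). \<forall>i.
        bij_betw (\<phi> i) (chain C i) (chain C' i) \<and>
        linear_between (chain C i) (\<phi> i) \<and>
        (\<forall>q. \<phi> i ` homog C i q = homog C' i q) \<and>
        (\<forall>x\<in>chain C i. \<phi> (i + 1) (dif C i x) = dif C' i (\<phi> i x)))"

text \<open>
  Linear functionals on \<open>chain C (- i)\<close> are represented by functions vanishing outside this set,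
  so that each of them has exactly one representative.
\<close>

definition dual_chain :: "('k, 'f::field UV) graded_complex \<Rightarrow> int \<Rightarrow> (('k \<Rightarrow> 'f UV) \<Rightarrow> 'f UV) set" where
  "dual_chain C i = {f. linear_to_ring (chain C (- i)) f \<and> (\<forall>x. x \<notin> chain C (- i) \<longrightarrow> f x = 0)}"

definition dual_complex :: "('k, 'f::field UV) graded_complex \<Rightarrow> ('k \<Rightarrow> 'f UV, 'f UV) graded_complex" where
  "dual_complex C = \<lparr>
     chain = dual_chain C,
     homog = (\<lambda>i q. {f \<in> dual_chain C i. \<forall>j. \<forall>x\<in>homog C (- i) j. f x \<in> homog_UV (j + q)}),
     dif = (\<lambda>i f x. if x \<in> chain C (- (i + 1)) then f (dif C (- (i + 1)) x) else 0)\<rparr>"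

section \<open>The complex of a diagram\<close>

text \<open>
  The basis of \<open>\<F>(D\<^sub>u) = A\<^bsup>\<otimes>k\<^esup>\<close> given by the tensor products of \<open>1\<close>'s and \<open>X\<close>'s is indexed by the
  set \<open>L\<close> of circles whose factor is \<open>X\<close>. An element of the direct sum over \<open>u\<close> is the function
  sending \<open>(I, L)\<close> to the corresponding coefficient.
\<close>

type_synonym 'e state = "nat set \<times> 'e set set"

definition states :: "'e diagram \<Rightarrow> 'e state set" where
  "states D = {(I, L). I \<subseteq> {..<n_cross D} \<and> L \<subseteq> circles D I}"

definition hgr :: "'e diagram \<Rightarrow> 'e state \<Rightarrow> int" where
  "hgr D = (\<lambda>(I, L). int (card I) - int (n_neg D))"

definition qgr :: "'e diagram \<Rightarrow> 'e state \<Rightarrow> int" where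
  "qgr D = (\<lambda>(I, L). int (card (circles D I - L)) - int (card L)
                      + int (card I) + int (n_pos D) - 2 * int (n_neg D))"

text \<open>
  \<open>saddle_coeff S T L M\<close> is the coefficient of the basis element \<open>M\<close> of \<open>A\<^bsup>\<otimes>T\<^esup>\<close> in the image of the
  basis element \<open>L\<close> of \<open>A\<^bsup>\<otimes>S\<^esup>\<close> under the saddle from the circles \<open>S\<close> to the circles \<open>T\<close>. The circles
  in \<open>S \<inter> T\<close> are those not meeting the saddle. The order of \<open>c\<^sub>1\<close> and \<open>c\<^sub>2\<close> does not matter, since
  \<open>A\<close> is commutative and cocommutative. The last case does not occur for planar diagrams.
\<close>

definition saddle_coeff ::
    "'e set set \<Rightarrow> 'e set set \<Rightarrow> 'e set set \<Rightarrow> 'e set set \<Rightarrow> 'f::field UV" where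
  "saddle_coeff S T L M =
     (if L \<inter> T \<noteq> M \<inter> S then 0
      else if card (S - T) = 2 \<and> card (T - S) = 1 then
        (let (c\<^sub>1, c\<^sub>2) = (SOME (c\<^sub>1, c\<^sub>2). S - T = {c\<^sub>1, c\<^sub>2}); c = the_elem (T - S)
         in mult_coeff (c\<^sub>1 \<in> L) (c\<^sub>2 \<in> L) (c \<in> M))
      else if card (S - T) = 1 \<and> card (T - S) = 2 then
        (let c = the_elem (S - T); (c\<^sub>1, c\<^sub>2) = (SOME (c\<^sub>1, c\<^sub>2). T - S = {c\<^sub>1, c\<^sub>2})
         in comult_coeff (c \<in> L) (c\<^sub>1 \<in> M) (c\<^sub>2 \<in> M))
      else 0)"

text \<open>
  \<open>s I i\<close> is the sign of the edge of the cube from \<open>I\<close> to \<open>insert i I\<close>. The saddle maps themselves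
  commute around each square, so the signs have to anticommute.
\<close>

definition sign_assignment :: "nat \<Rightarrow> (nat set \<Rightarrow> nat \<Rightarrow> int) \<Rightarrow> bool" where
  "sign_assignment n s \<longleftrightarrow>
     (\<forall>I i. I \<subseteq> {..<n} \<and> i < n \<and> i \<notin> I \<longrightarrow> s I i \<in> {1, - 1}) \<and>
     (\<forall>I i j. I \<subseteq> {..<n} \<and> i < n \<and> j < n \<and> i \<notin> I \<and> j \<notin> I \<and> i \<noteq> j \<longrightarrow>
        s I i * s (insert i I) j = - (s I j * s (insert j I) i))"

definition CKh_dif ::
    "(nat set \<Rightarrow> nat \<Rightarrow> int) \<Rightarrow> 'e diagram \<Rightarrow> ('e state \<Rightarrow> 'f::field UV) \<Rightarrow> 'e state \<Rightarrow> 'f UV" where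
  "CKh_dif s D x = (\<lambda>(J, M).
     if (J, M) \<in> states D then
       \<Sum>i\<in>J. \<Sum>L\<in>Pow (circles D (J - {i})).
         of_int (s (J - {i}) i) * saddle_coeff (circles D (J - {i})) (circles D J) L M * x (J - {i}, L)
     else 0)"

definition CKh_chain :: "'e diagram \<Rightarrow> int \<Rightarrow> ('e state \<Rightarrow> 'f::field UV) set" where
  "CKh_chain D i = {x. \<forall>k. x k \<noteq> 0 \<longrightarrow> k \<in> states D \<and> hgr D k = i}"

definition CKh :: "(nat set \<Rightarrow> nat \<Rightarrow> int) \<Rightarrow> 'e diagram \<Rightarrow> ('e state, 'f::field UV) graded_complex" where
  "CKh s D = \<lparr>
     chain = CKh_chain D,
     homog = (\<lambda>i q. {x \<in> CKh_chain D i. \<forall>k\<in>states D. x k \<in> homog_UV (q - qgr D k)}),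
     dif = (\<lambda>i. CKh_dif s D)\<rparr>"

section \<open>The reduced complex\<close>

definition basepoint_map ::
    "'e diagram \<Rightarrow> 'e \<Rightarrow> ('e state \<Rightarrow> 'f::field UV) \<Rightarrow> 'e state \<Rightarrow> 'f UV" where
  "basepoint_map D p x = (\<lambda>(I, M).
     if (I, M) \<in> states D then
       \<Sum>L\<in>Pow (circles D I).
         (let c = circle_at D I p in
            if L - {c} = M - {c}
            then mult_coeff True (c \<in> L) (c \<in> M) - U * mult_coeff False (c \<in> L) (c \<in> M)
            else 0) * x (I, L)
     else 0)"

definition reduced_CKh ::
    "(nat set \<Rightarrow> nat \<Rightarrow> int) \<Rightarrow> 'e diagram \<Rightarrow> 'e \<Rightarrow> ('e state, 'f::field UV) graded_complex" where
  "reduced_CKh s D p = \<lparr>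
     chain = (\<lambda>i. basepoint_map D p ` chain (CKh s D) i),
     homog = (\<lambda>i q. basepoint_map D p ` chain (CKh s D) i \<inter> homog (CKh s D) i (q - 1)),
     dif = dif (CKh s D)\<rparr>"

end

theory Submission
  imports Defs
begin

text \<open>
  The duality comes from the Frobenius pairing \<open>\<langle>a, b\<rangle> = \<epsilon>(ab)\<close> on \<open>A\<close>. Switching all crossings
  exchanges the two smoothings, so the circles of \<open>D\<close> at a vertex \<open>I\<close> of the cube are the circles of the
  mirror image at the complementary vertex, and an edge of one cube is an edge of the other in
  reverse direction. The tensor powers of the Frobenius pairing therefore pair the two
  complexes (\<open>cube_pairing\<close>). This pairing is perfect (\<open>frobenius_pairing_dual_basis\<close>,
  \<open>cube_pairing_perfect\<close>) and graded (\<open>cube_pairing_homogeneous\<close>). Comultiplication is the adjoint of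
  multiplication, so the saddle map of an edge is adjoint to that of the reversed edge
  (\<open>saddle_map_adjoint\<close>). The signs are corrected by a function \<open>\<eta>\<close> on the vertices, which exists since
  any two sign assignments differ by a coboundary (\<open>sign_assignments_cohomologous\<close>). Altogether the two
  differentials are adjoint (\<open>cube_pairing_dif\<close>).

  For the reduced complexes, the basepoint map \<open>f\<^sub>p\<close> is self-adjoint (\<open>cube_pairing_basepoint_map\<close>) and
  commutes with the differentials (\<open>basepoint_map_commutes\<close>). Hence
  \<open>(f\<^sub>p x, f\<^sub>p y) \<mapsto> \<langle>x, f\<^sub>p y\<rangle> = \<langle>f\<^sub>p x, y\<rangle>\<close>
  is a well-defined pairing between the images of the basepoint maps of \<open>D\<close> and its mirror image, for
  which the differentials are again adjoint. It is perfect, because the image of \<open>f\<^sub>p\<close> is a direct summand,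
  so that functionals on it extend to the whole complex. The isomorphism sends \<open>f\<^sub>p x\<close> to the
  functional \<open>f\<^sub>p y \<mapsto> \<langle>x, f\<^sub>p y\<rangle>\<close>. As \<open>f\<^sub>p\<close> has degree \<open>-2\<close>, this pairing has degree \<open>2\<close> with respect
  to the unreduced gradings, and the two shifts by \<open>1\<close> in the definition of the reduced complexes
  make it graded.
\<close>

section \<open>The Frobenius pairing on tensor powers\<close>

text \<open>
  The pairing \<open>(a, b) \<mapsto> \<epsilon>(ab)\<close> of the Frobenius algebra \<open>A\<close> takes the values \<open>0, 1, U + V\<close> on
  \<open>(1, 1)\<close>, \<open>(1, X)\<close> and \<open>(X, X)\<close>. On \<open>A\<^bsup>\<otimes>S\<^esup>\<close> this gives, for the basis elements with sets \<open>L\<close> and \<open>M\<close>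
  of factors \<open>X\<close>, zero if some circle lies in neither set and otherwise one factor \<open>U + V\<close> for each
  circle in both.
\<close>
definition frobenius_pairing ::
    "'c set \<Rightarrow> ('c set \<Rightarrow> 'f::field UV) \<Rightarrow> ('c set \<Rightarrow> 'f UV) \<Rightarrow> 'f UV" where
  "frobenius_pairing S x y =
     (\<Sum>L\<in>Pow S. \<Sum>M\<in>Pow S. if L \<union> M = S then (U + V) ^ card (L \<inter> M) * x L * y M else 0)"

lemma frobenius_pairing_cong:
  assumes "\<And>L. L \<subseteq> S \<Longrightarrow> x L = x' L" and "\<And>L. L \<subseteq> S \<Longrightarrow> y L = y' L"
  shows "frobenius_pairing S x y = frobenius_pairing S x' y'"
  unfolding frobenius_pairing_def using assms by (intro sum.cong) auto

lemma frobenius_pairing_commute: "frobenius_pairing S x y = frobenius_pairing S y x"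
  unfolding frobenius_pairing_def
  by (subst sum.swap) (intro sum.cong refl, simp add: Un_commute Int_commute mult_ac)

lemma frobenius_pairing_add_left:
  "frobenius_pairing S (\<lambda>L. x L + x' L) y = frobenius_pairing S x y + frobenius_pairing S x' y"
  unfolding frobenius_pairing_def sum.distrib[symmetric]
  by (intro sum.cong refl) (simp add: algebra_simps)

lemma frobenius_pairing_scale_left:
  "frobenius_pairing S (\<lambda>L. r * x L) y = r * frobenius_pairing S x y"
  unfolding frobenius_pairing_def sum_distrib_left
  by (intro sum.cong refl) (simp add: algebra_simps)

lemma frobenius_pairing_add_right:
  "frobenius_pairing S x (\<lambda>L. y L + y' L) = frobenius_pairing S x y + frobenius_pairing S x y'"
  by (simp add: frobenius_pairing_commute[of S x] frobenius_pairing_add_left)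

lemma frobenius_pairing_scale_right:
  "frobenius_pairing S x (\<lambda>L. r * y L) = r * frobenius_pairing S x y"
  by (simp add: frobenius_pairing_commute[of S x] frobenius_pairing_scale_left)

lemma frobenius_pairing_zero_left: "frobenius_pairing S (\<lambda>L. 0) y = 0"
  unfolding frobenius_pairing_def by (intro sum.neutral ballI) simp

lemma frobenius_pairing_zero_right: "frobenius_pairing S x (\<lambda>L. 0) = 0"
  unfolding frobenius_pairing_def by (intro sum.neutral ballI) simp

lemma frobenius_pairing_sum_left:
  "frobenius_pairing S (\<lambda>L. \<Sum>i\<in>A. x i L) y = (\<Sum>i\<in>A. frobenius_pairing S (x i) y)"
  by (induction A rule: infinite_finite_induct)
    (simp_all add: frobenius_pairing_zero_left frobenius_pairing_add_left)

lemma frobenius_pairing_sum_right: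
  "frobenius_pairing S x (\<lambda>L. \<Sum>i\<in>A. y i L) = (\<Sum>i\<in>A. frobenius_pairing S x (y i))"
  by (simp add: frobenius_pairing_commute[of S x] frobenius_pairing_sum_left)

lemmas frobenius_pairing_linear =
  frobenius_pairing_add_left frobenius_pairing_add_right
  frobenius_pairing_scale_left frobenius_pairing_scale_right

lemma sum_Pow_insert:
  assumes "finite S" "c \<notin> S"
  shows "(\<Sum>L\<in>Pow (insert c S). h L) = (\<Sum>L\<in>Pow S. h L + h (insert c L))"
proof -
  have "inj_on (insert c) (Pow S)"
    using assms by (auto simp: inj_on_def)
  moreover have "Pow S \<inter> insert c ` Pow S = {}" using assms by auto
  ultimately show ?thesis
    using assms by (simp add: Pow_insert sum.union_disjoint sum.reindex sum.distrib)
qed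

text \<open>
  Splitting off the factor of one circle \<open>c\<close>, an element \<open>x\<close> of the tensor power becomes \<open>x\<^sub>0 \<otimes> 1 + x\<^sub>1 \<otimes> X\<close>
  with \<open>x\<^sub>0 = x\<close> and \<open>x\<^sub>1 = x \<circ> insert c\<close> as functions on the subsets of \<open>S\<close>. All statements about the
  pairing that concern only a few circles are reduced by this formula to bilinear algebra.
\<close>
lemma frobenius_pairing_insert:
  assumes "finite S" "c \<notin> S"
  shows "frobenius_pairing (insert c S) x y =
     frobenius_pairing S x (\<lambda>L. y (insert c L)) + frobenius_pairing S (\<lambda>L. x (insert c L)) y
     + (U + V) * frobenius_pairing S (\<lambda>L. x (insert c L)) (\<lambda>L. y (insert c L))"
proof -
  have fin: "finite L" if "L \<in> Pow S" for L using that assms finite_subset by auto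
  have "frobenius_pairing (insert c S) x y = (\<Sum>L\<in>Pow S. \<Sum>M\<in>Pow S.
      (if L \<union> M = S then (U + V) ^ card (L \<inter> M) * x L * y (insert c M) else 0)
    + (if L \<union> M = S then (U + V) ^ card (L \<inter> M) * x (insert c L) * y M else 0)
    + (if L \<union> M = S then (U + V) * ((U + V) ^ card (L \<inter> M) * x (insert c L) * y (insert c M)) else 0))"
    unfolding frobenius_pairing_def sum_Pow_insert[OF assms] sum.distrib[symmetric]
  proof (intro sum.cong refl)
    fix L M assume LM: "L \<in> Pow S" "M \<in> Pow S"
    then have "c \<notin> L" "c \<notin> M" using assms by auto
    moreover have "L \<union> M \<noteq> insert c S" using LM assms by auto
    moreover have "insert c (L \<union> M) = insert c S \<longleftrightarrow> L \<union> M = S"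
      using LM assms by (intro insert_ident) auto
    moreover have "card (insert c (L \<inter> M)) = Suc (card (L \<inter> M))"
      using \<open>c \<notin> L\<close> fin[OF LM(1)] by simp
    ultimately show "(if L \<union> M = insert c S then (U + V) ^ card (L \<inter> M) * x L * y M else 0) +
        (if L \<union> insert c M = insert c S then (U + V) ^ card (L \<inter> insert c M) * x L * y (insert c M) else 0) +
        ((if insert c L \<union> M = insert c S then (U + V) ^ card (insert c L \<inter> M) * x (insert c L) * y M else 0) +
         (if insert c L \<union> insert c M = insert c S
          then (U + V) ^ card (insert c L \<inter> insert c M) * x (insert c L) * y (insert c M) else 0)) =
        (if L \<union> M = S then (U + V) ^ card (L \<inter> M) * x L * y (insert c M) else 0) +
        (if L \<union> M = S then (U + V) ^ card (L \<inter> M) * x (insert c L) * y M else 0) +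
        (if L \<union> M = S then (U + V) * ((U + V) ^ card (L \<inter> M) * x (insert c L) * y (insert c M)) else 0)"
      by (simp add: mult_ac)
  qed
  also have "\<dots> = frobenius_pairing S x (\<lambda>L. y (insert c L)) + frobenius_pairing S (\<lambda>L. x (insert c L)) y
     + (U + V) * frobenius_pairing S (\<lambda>L. x (insert c L)) (\<lambda>L. y (insert c L))"
    unfolding frobenius_pairing_def sum.distrib sum_distrib_left
    by (intro arg_cong2[where f="(+)"] sum.cong refl) auto
  finally show ?thesis .
qed

text \<open>
  For one circle the basis dual to \<open>1, X\<close> is \<open>X - (U + V), 1\<close>; the tensor products of these elements
  form the basis dual to the standard one.
\<close>
definition dual_basis :: "'c set \<Rightarrow> 'c set \<Rightarrow> 'c set \<Rightarrow> 'f::field UV" where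
  "dual_basis S K M = (if K \<inter> M = {} then (- (U + V)) ^ card (S - (K \<union> M)) else 0)"

lemma frobenius_pairing_dual_basis:
  assumes "finite S" "K \<subseteq> S"
  shows "frobenius_pairing S x (dual_basis S K) = x K"
  using assms
proof (induction S arbitrary: K x rule: finite_induct)
  case empty
  then show ?case by (simp add: frobenius_pairing_def dual_basis_def)
next
  case (insert c S)
  let ?e = "dual_basis (insert c S) K :: _ \<Rightarrow> 'b UV"
  show ?case
  proof (cases "c \<in> K")
    case True
    have K': "K - {c} \<subseteq> S" using insert.prems by auto
    have "?e (insert c M) = 0" for M using True by (simp add: dual_basis_def)
    moreover have "?e M = dual_basis S (K - {c}) M" if "M \<subseteq> S" for M
    proof -
      have "K \<inter> M = {} \<longleftrightarrow> (K - {c}) \<inter> M = {}" "insert c S - (K \<union> M) = S - (K - {c} \<union> M)"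
        using that True insert.hyps by auto
      then show ?thesis by (simp add: dual_basis_def)
    qed
    then have "frobenius_pairing S x' ?e = x' (K - {c})" for x'
      using insert.IH[OF K', of x'] by (simp cong: frobenius_pairing_cong)
    ultimately show ?thesis
      using True insert.hyps
      by (simp add: frobenius_pairing_insert frobenius_pairing_zero_right insert_absorb)
  next
    case False
    have K': "K \<subseteq> S" using insert.prems False by auto
    have "?e (insert c M) = dual_basis S K M" if "M \<subseteq> S" for M
    proof -
      have "insert c S - (K \<union> insert c M) = S - (K \<union> M)" using insert.hyps by auto
      then show ?thesis using False by (simp add: dual_basis_def)
    qed
    then have 1: "frobenius_pairing S x' (\<lambda>M. ?e (insert c M)) = x' K" for x'
      using insert.IH[OF K', of x'] by (simp cong: frobenius_pairing_cong)
    have "?e M = - (U + V) * dual_basis S K M" if "M \<subseteq> S" for M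
    proof -
      have "insert c S - (K \<union> M) = insert c (S - (K \<union> M))" "c \<notin> S - (K \<union> M)"
        using insert.hyps that False by auto
      then show ?thesis using insert.hyps by (simp add: dual_basis_def)
    qed
    then have 2: "frobenius_pairing S x' ?e = - (U + V) * x' K" for x'
      using insert.IH[OF K', of x'] frobenius_pairing_scale_right[of S x' "- (U + V)"]
      by (simp cong: frobenius_pairing_cong)
    show ?thesis
      by (simp only: frobenius_pairing_insert[OF insert.hyps] 1 2) (simp add: algebra_simps)
  qed
qed

section \<open>Multiplication by X - U\<close>

definition mult_X_minus_U :: "'c \<Rightarrow> ('c set \<Rightarrow> 'f::field UV) \<Rightarrow> 'c set \<Rightarrow> 'f UV" where
  "mult_X_minus_U c x M =
     (if c \<in> M then x (M - {c}) + V * x M else - U * (x M + V * x (insert c M)))"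

definition div_X_minus_U :: "'c \<Rightarrow> ('c set \<Rightarrow> 'f::field UV) \<Rightarrow> 'c set \<Rightarrow> 'f UV" where
  "div_X_minus_U c x M = (if c \<in> M then 0 else x (insert c M))"

text \<open>
  Since \<open>X (X - U) = V (X - U)\<close>, the image of multiplication by \<open>X - U\<close> is generated by the elements
  \<open>X - U\<close> times tensors in the other factors. Such an element is determined by its coefficients at the
  sets containing \<open>c\<close>, and dividing by \<open>X - U\<close> means reading off these coefficients.
\<close>
lemma mult_div_mult_X_minus_U:
  "mult_X_minus_U c (div_X_minus_U c (mult_X_minus_U c x)) = mult_X_minus_U c x"
  by (rule ext) (auto simp: mult_X_minus_U_def div_X_minus_U_def insert_absorb algebra_simps)

text \<open>
  Multiplication by an element of a commutative Frobenius algebra is self-adjoint: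
  \<open>\<epsilon>((ra)b) = \<epsilon>(a(rb))\<close>.
\<close>
lemma mult_X_minus_U_self_adjoint:
  fixes x y :: "'c set \<Rightarrow> 'f::field UV"
  assumes "finite S" "c \<in> S"
  shows "frobenius_pairing S (mult_X_minus_U c x) y = frobenius_pairing S x (mult_X_minus_U c y)"
proof -
  define Z where "Z = S - {c}"
  have S: "S = insert c Z" "finite Z" "c \<notin> Z" using assms by (auto simp: Z_def)
  have 1: "mult_X_minus_U c w (insert c L) = w L + V * w (insert c L)"
    and 0: "mult_X_minus_U c w L = (- U) * w L + (- U * V) * w (insert c L)"
    if "L \<subseteq> Z" for L and w :: "'c set \<Rightarrow> 'f UV"
  proof -
    have "c \<notin> L" using that S by auto
    then show "mult_X_minus_U c w (insert c L) = w L + V * w (insert c L)"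
      "mult_X_minus_U c w L = (- U) * w L + (- U * V) * w (insert c L)"
      by (auto simp: mult_X_minus_U_def algebra_simps)
  qed
  have r: "frobenius_pairing Z w (mult_X_minus_U c v) =
        frobenius_pairing Z w (\<lambda>L. (- U) * v L + (- U * V) * v (insert c L))"
      "frobenius_pairing Z w (\<lambda>L. mult_X_minus_U c v (insert c L)) =
        frobenius_pairing Z w (\<lambda>L. v L + V * v (insert c L))" for v w :: "'c set \<Rightarrow> 'f UV"
    by - (rule frobenius_pairing_cong; simp only: 0 1)+
  have l: "frobenius_pairing Z (mult_X_minus_U c v) w =
        frobenius_pairing Z (\<lambda>L. (- U) * v L + (- U * V) * v (insert c L)) w"
      "frobenius_pairing Z (\<lambda>L. mult_X_minus_U c v (insert c L)) w =
        frobenius_pairing Z (\<lambda>L. v L + V * v (insert c L)) w" for v w :: "'c set \<Rightarrow> 'f UV"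
    by - (rule frobenius_pairing_cong; simp only: 0 1)+
  show ?thesis
    unfolding S(1) frobenius_pairing_insert[OF S(2,3)] l r frobenius_pairing_linear
    by (simp add: algebra_simps)
qed

section \<open>Saddles\<close>

definition saddle_map ::
    "'e set set \<Rightarrow> 'e set set \<Rightarrow> ('e set set \<Rightarrow> 'f::field UV) \<Rightarrow> 'e set set \<Rightarrow> 'f UV" where
  "saddle_map S T x M = (\<Sum>L\<in>Pow S. saddle_coeff S T L M * x L)"

lemma saddle_coeff_merge:
  assumes "S - T = {a, b}" "a \<noteq> b" "T - S = {c}"
  shows "saddle_coeff S T L M =
    (if L \<inter> T \<noteq> M \<inter> S then 0 else mult_coeff (a \<in> L) (b \<in> L) (c \<in> M))"
proof -
  define pr where "pr = (SOME (c\<^sub>1, c\<^sub>2). S - T = {c\<^sub>1, c\<^sub>2})"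
  have "case pr of (c\<^sub>1, c\<^sub>2) \<Rightarrow> S - T = {c\<^sub>1, c\<^sub>2}"
    unfolding pr_def by (rule someI[of _ "(a, b)"]) (use assms in simp)
  then have "pr = (a, b) \<or> pr = (b, a)" using assms by (auto simp: doubleton_eq_iff)
  moreover have "mult_coeff (b \<in> L) (a \<in> L) (c \<in> M) = mult_coeff (a \<in> L) (b \<in> L) (c \<in> M)"
    by (cases "a \<in> L"; cases "b \<in> L"; cases "c \<in> M") simp_all
  ultimately show ?thesis
    using assms unfolding saddle_coeff_def pr_def[symmetric] by (auto simp: Let_def)
qed

lemma saddle_coeff_split:
  assumes "T - S = {a, b}" "a \<noteq> b" "S - T = {c}"
  shows "saddle_coeff S T L M =
    (if L \<inter> T \<noteq> M \<inter> S then 0 else comult_coeff (c \<in> L) (a \<in> M) (b \<in> M))"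
proof -
  define pr where "pr = (SOME (c\<^sub>1, c\<^sub>2). T - S = {c\<^sub>1, c\<^sub>2})"
  have "case pr of (c\<^sub>1, c\<^sub>2) \<Rightarrow> T - S = {c\<^sub>1, c\<^sub>2}"
    unfolding pr_def by (rule someI[of _ "(a, b)"]) (use assms in simp)
  then have "pr = (a, b) \<or> pr = (b, a)" using assms by (auto simp: doubleton_eq_iff)
  moreover have "comult_coeff (c \<in> L) (b \<in> M) (a \<in> M) = comult_coeff (c \<in> L) (a \<in> M) (b \<in> M)"
    by (cases "c \<in> L"; cases "b \<in> M"; cases "a \<in> M") simp_all
  ultimately show ?thesis
    using assms unfolding saddle_coeff_def pr_def[symmetric] by (auto simp: Let_def)
qed

text \<open>
  The circles \<open>a\<close> and \<open>b\<close> of \<open>S\<close> merge into the circle \<open>c\<close> of \<open>T\<close>, and \<open>Z\<close> consists of the circles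
  that do not meet the saddle.
\<close>
definition merging :: "'c set \<Rightarrow> 'c set \<Rightarrow> 'c set \<Rightarrow> 'c \<Rightarrow> 'c \<Rightarrow> 'c \<Rightarrow> bool" where
  "merging S T Z a b c \<longleftrightarrow> finite Z \<and> S = insert a (insert b Z) \<and> T = insert c Z \<and>
     a \<notin> Z \<and> b \<notin> Z \<and> c \<notin> Z \<and> a \<noteq> b \<and> c \<noteq> a \<and> c \<noteq> b"

text \<open>
  The three cases are preserved by exchanging \<open>S\<close> and \<open>T\<close>, the first two being swapped. In the third
  one the saddle maps in both directions are zero.
\<close>
lemma saddle_cases:
  assumes "finite S" "finite T"
  obtains (merge) Z a b c where "merging S T Z a b c"
  | (split) Z a b c where "merging T S Z a b c"
  | (none) "\<not> (card (S - T) = 2 \<and> card (T - S) = 1)" "\<not> (card (T - S) = 2 \<and> card (S - T) = 1)"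
proof -
  have *: "\<exists>Z a b c. merging S T Z a b c"
    if "card (S - T) = 2" "card (T - S) = 1" "finite S" for S T :: "'a set"
  proof -
    obtain a b where ab: "S - T = {a, b}" "a \<noteq> b" using \<open>card (S - T) = 2\<close> by (metis card_2_iff)
    obtain c where c: "T - S = {c}" using \<open>card (T - S) = 1\<close> by (rule card_1_singletonE)
    have "a \<in> S - T" "b \<in> S - T" "c \<in> T - S" by (simp_all add: ab c)
    moreover have "S = (S - T) \<union> (S \<inter> T)" "T = (T - S) \<union> (S \<inter> T)" by blast+
    then have "S = insert a (insert b (S \<inter> T))" "T = insert c (S \<inter> T)" by (simp_all add: ab c)
    ultimately have "merging S T (S \<inter> T) a b c"
      unfolding merging_def using ab(2) \<open>finite S\<close> by blast
    then show ?thesis by blast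
  qed
  show ?thesis
  proof (cases "card (S - T) = 2 \<and> card (T - S) = 1")
    case True
    then show ?thesis using *[of S T] assms(1) merge by blast
  next
    case not_merge: False
    show ?thesis
    proof (cases "card (T - S) = 2 \<and> card (S - T) = 1")
      case True
      then show ?thesis using *[of T S] assms(2) split by blast
    next
      case False
      then show ?thesis by (rule none[OF not_merge])
    qed
  qed
qed

lemma saddle_map_eq_zero:
  fixes x :: "'e set set \<Rightarrow> 'f::field UV"
  assumes "\<not> (card (S - T) = 2 \<and> card (T - S) = 1)" "\<not> (card (T - S) = 2 \<and> card (S - T) = 1)"
  shows "saddle_map S T x = (\<lambda>M. 0)"
proof -
  have "saddle_coeff S T L M = (0 :: 'f UV)" for L M using assms unfolding saddle_coeff_def by auto
  then show ?thesis by (auto simp: saddle_map_def)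
qed

text \<open>
  The coefficients of an element of the target at \<open>K\<close> and \<open>insert c K\<close>, for a labelling \<open>K\<close> of the circles
  that the saddle does not meet, depend only on the four coefficients in the source that extend the
  same labelling \<open>K\<close>. The factors \<open>- U * V\<close> and \<open>U + V\<close> come from \<open>X\<^sup>2 = (U + V) X - U V\<close>.
\<close>
lemma merge_map:
  fixes x :: "'e set set \<Rightarrow> 'f::field UV"
  assumes "merging S T Z a b c" "K \<subseteq> Z"
  shows "saddle_map S T x K = x K - U * V * x (insert a (insert b K))"
    and "saddle_map S T x (insert c K) =
      x (insert a K) + x (insert b K) + (U + V) * x (insert a (insert b K))"
proof -
  have m: "finite Z" "S = insert a (insert b Z)" "T = insert c Z"
     "a \<notin> Z" "b \<notin> Z" "c \<notin> Z" "a \<noteq> b" "c \<noteq> a" "c \<noteq> b"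
    using assms by (auto simp: merging_def)
  have K: "a \<notin> K" "b \<notin> K" "c \<notin> K" using assms m by auto
  have coeff: "saddle_coeff S T L M =
    (if L \<inter> Z \<noteq> M \<inter> Z then 0 else mult_coeff (a \<in> L) (b \<in> L) (c \<in> M) :: 'f UV)"
    if "L \<subseteq> S" "M \<subseteq> T" for L M
  proof -
    have "S - T = {a, b}" "T - S = {c}" "L \<inter> T = L \<inter> Z" "M \<inter> S = M \<inter> Z"
      using that m by auto
    then show ?thesis using saddle_coeff_merge[of S T a b c L M] \<open>a \<noteq> b\<close> by simp
  qed
  have sum: "saddle_map S T x M =
      mult_coeff False False (c \<in> M) * x K + mult_coeff True False (c \<in> M) * x (insert a K)
    + mult_coeff False True (c \<in> M) * x (insert b K)
    + mult_coeff True True (c \<in> M) * x (insert a (insert b K))"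
    if M: "M \<subseteq> T" "M \<inter> Z = K" for M
  proof -
    have "saddle_map S T x M =
      (\<Sum>L\<in>Pow S. (if L \<inter> Z \<noteq> K then 0 else mult_coeff (a \<in> L) (b \<in> L) (c \<in> M)) * x L)"
      unfolding saddle_map_def by (intro sum.cong refl) (simp add: coeff M)
    also have "\<dots> = (\<Sum>L\<in>Pow Z. if L = K then
      mult_coeff False False (c \<in> M) * x K + mult_coeff True False (c \<in> M) * x (insert a K)
    + mult_coeff False True (c \<in> M) * x (insert b K)
    + mult_coeff True True (c \<in> M) * x (insert a (insert b K)) else 0)"
      unfolding m(2)
      apply (subst sum_Pow_insert, use m in simp, use m in simp)
      apply (subst sum_Pow_insert, use m in simp, use m in simp)
      apply (intro sum.cong refl)
      subgoal for L
      proof -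
        assume "L \<in> Pow Z"
        then have "L \<inter> Z = L" "a \<notin> L" "b \<notin> L" using m by auto
        then show ?thesis using m K by (simp add: algebra_simps)
      qed
      done
    also have "\<dots> = mult_coeff False False (c \<in> M) * x K + mult_coeff True False (c \<in> M) * x (insert a K)
    + mult_coeff False True (c \<in> M) * x (insert b K)
    + mult_coeff True True (c \<in> M) * x (insert a (insert b K))"
      using m assms by (simp add: sum.delta)
    finally show ?thesis .
  qed
  show "saddle_map S T x K = x K - U * V * x (insert a (insert b K))"
    using sum[of K] K assms m by auto
  show "saddle_map S T x (insert c K) =
      x (insert a K) + x (insert b K) + (U + V) * x (insert a (insert b K))"
    using sum[of "insert c K"] K assms m by auto
qed

lemma split_map:
  fixes x :: "'e set set \<Rightarrow> 'f::field UV"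
  assumes "merging S T Z a b c" "K \<subseteq> Z"
  shows "saddle_map T S x K = - (U + V) * x K - U * V * x (insert c K)"
    and "saddle_map T S x (insert a K) = x K"
    and "saddle_map T S x (insert b K) = x K"
    and "saddle_map T S x (insert a (insert b K)) = x (insert c K)"
proof -
  have m: "finite Z" "S = insert a (insert b Z)" "T = insert c Z"
     "a \<notin> Z" "b \<notin> Z" "c \<notin> Z" "a \<noteq> b" "c \<noteq> a" "c \<noteq> b"
    using assms by (auto simp: merging_def)
  have K: "a \<notin> K" "b \<notin> K" "c \<notin> K" using assms m by auto
  have coeff: "saddle_coeff T S L M =
    (if L \<inter> Z \<noteq> M \<inter> Z then 0 else comult_coeff (c \<in> L) (a \<in> M) (b \<in> M) :: 'f UV)"
    if "L \<subseteq> T" "M \<subseteq> S" for L M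
  proof -
    have "S - T = {a, b}" "T - S = {c}" "L \<inter> S = L \<inter> Z" "M \<inter> T = M \<inter> Z"
      using that m by auto
    then show ?thesis using saddle_coeff_split[of S T a b c L M] \<open>a \<noteq> b\<close> by simp
  qed
  have sum: "saddle_map T S x M =
      comult_coeff False (a \<in> M) (b \<in> M) * x K + comult_coeff True (a \<in> M) (b \<in> M) * x (insert c K)"
    if M: "M \<subseteq> S" "M \<inter> Z = K" for M
  proof -
    have "saddle_map T S x M =
      (\<Sum>L\<in>Pow T. (if L \<inter> Z \<noteq> K then 0 else comult_coeff (c \<in> L) (a \<in> M) (b \<in> M)) * x L)"
      unfolding saddle_map_def by (intro sum.cong refl) (simp add: coeff M)
    also have "\<dots> = (\<Sum>L\<in>Pow Z. if L = K then comult_coeff False (a \<in> M) (b \<in> M) * x K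
        + comult_coeff True (a \<in> M) (b \<in> M) * x (insert c K) else 0)"
      unfolding m(3)
      apply (subst sum_Pow_insert, use m in simp, use m in simp)
      apply (intro sum.cong refl)
      subgoal for L
      proof -
        assume "L \<in> Pow Z"
        then have "L \<inter> Z = L" "c \<notin> L" using m by auto
        then show ?thesis using m K by (simp add: algebra_simps)
      qed
      done
    also have "\<dots> = comult_coeff False (a \<in> M) (b \<in> M) * x K
        + comult_coeff True (a \<in> M) (b \<in> M) * x (insert c K)"
      using m assms by (simp add: sum.delta)
    finally show ?thesis .
  qed
  show "saddle_map T S x K = - (U + V) * x K - U * V * x (insert c K)"
    using sum[of K] K assms m by auto
  show "saddle_map T S x (insert a K) = x K"
    using sum[of "insert a K"] K assms m by auto
  show "saddle_map T S x (insert b K) = x K"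
    using sum[of "insert b K"] K assms m by auto
  show "saddle_map T S x (insert a (insert b K)) = x (insert c K)"
    using sum[of "insert a (insert b K)"] K assms m by auto
qed

text \<open>
  The comultiplication of a Frobenius algebra is adjoint to its multiplication. With the explicit structure constants this is an identity between bilinear expressions in the
  components of \<open>x\<close> and \<open>y\<close> with respect to the circles \<open>a\<close>, \<open>b\<close> and \<open>c\<close>.
\<close>
lemma merge_split_adjoint:
  fixes x y :: "'e set set \<Rightarrow> 'f::field UV"
  assumes "merging S T Z a b c"
  shows "frobenius_pairing T (saddle_map S T x) y = frobenius_pairing S x (saddle_map T S y)"
proof -
  have m: "finite Z" "S = insert a (insert b Z)" "T = insert c Z"
     "a \<notin> Z" "b \<notin> Z" "c \<notin> Z" "a \<noteq> b" "c \<noteq> a" "c \<noteq> b"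
    using assms by (auto simp: merging_def)
  have T: "frobenius_pairing T v w =
     frobenius_pairing Z v (\<lambda>L. w (insert c L)) + frobenius_pairing Z (\<lambda>L. v (insert c L)) w
     + (U + V) * frobenius_pairing Z (\<lambda>L. v (insert c L)) (\<lambda>L. w (insert c L))"
    for v w :: "'e set set \<Rightarrow> 'f UV"
    unfolding m(3) using m by (simp add: frobenius_pairing_insert)
  have S: "frobenius_pairing S v w =
     frobenius_pairing (insert b Z) v (\<lambda>L. w (insert a L))
     + frobenius_pairing (insert b Z) (\<lambda>L. v (insert a L)) w
     + (U + V) * frobenius_pairing (insert b Z) (\<lambda>L. v (insert a L)) (\<lambda>L. w (insert a L))"
     "frobenius_pairing (insert b Z) v w =
     frobenius_pairing Z v (\<lambda>L. w (insert b L)) + frobenius_pairing Z (\<lambda>L. v (insert b L)) w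
     + (U + V) * frobenius_pairing Z (\<lambda>L. v (insert b L)) (\<lambda>L. w (insert b L))"
    for v w :: "'e set set \<Rightarrow> 'f UV"
    unfolding m(2) using m by (simp_all add: frobenius_pairing_insert)
  have l: "frobenius_pairing Z (saddle_map S T x) w =
      frobenius_pairing Z (\<lambda>K. x K + (- U * V) * x (insert a (insert b K))) w"
    "frobenius_pairing Z (\<lambda>K. saddle_map S T x (insert c K)) w =
      frobenius_pairing Z (\<lambda>K. x (insert a K) + (x (insert b K) + (U + V) * x (insert a (insert b K)))) w"
    for w
    by - (rule frobenius_pairing_cong; simp add: merge_map[OF assms] algebra_simps)+
  have r: "frobenius_pairing Z w (saddle_map T S y) =
      frobenius_pairing Z w (\<lambda>K. (- (U + V)) * y K + (- U * V) * y (insert c K))"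
    "frobenius_pairing Z w (\<lambda>K. saddle_map T S y (insert a K)) = frobenius_pairing Z w y"
    "frobenius_pairing Z w (\<lambda>K. saddle_map T S y (insert b K)) = frobenius_pairing Z w y"
    "frobenius_pairing Z w (\<lambda>K. saddle_map T S y (insert a (insert b K))) =
      frobenius_pairing Z w (\<lambda>K. y (insert c K))"
    for w
    by - (rule frobenius_pairing_cong; simp add: split_map[OF assms] algebra_simps)+
  show ?thesis
    unfolding T S l r frobenius_pairing_linear
    by (simp add: algebra_simps)
qed

lemma saddle_map_adjoint:
  assumes "finite S" "finite T"
  shows "frobenius_pairing T (saddle_map S T x) y = frobenius_pairing S x (saddle_map T S y)"
  using assms
proof (cases rule: saddle_cases)
  case (merge Z a b c)
  then show ?thesis by (rule merge_split_adjoint)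
next
  case (split Z a b c)
  then show ?thesis using merge_split_adjoint[OF split, of y x]
    by (simp add: frobenius_pairing_commute)
next
  case none
  then show ?thesis
    by (simp add: saddle_map_eq_zero frobenius_pairing_zero_left frobenius_pairing_zero_right)
qed

lemma subset_insertE:
  assumes "M \<subseteq> insert c Z" "c \<notin> Z"
  obtains "M \<subseteq> Z" "c \<notin> M" | K where "K \<subseteq> Z" "c \<notin> K" "M = insert c K"
proof (cases "c \<in> M")
  case True
  show ?thesis by (rule that(2)[of "M - {c}"]) (use True assms in auto)
next
  case False
  then show ?thesis using assms that(1) by auto
qed

text \<open>
  Multiplication and comultiplication are maps of \<open>A\<close>-modules, so that multiplication by \<open>X - U\<close> can be
  moved across the saddle: it stays on its circle if the saddle does not meet that circle, and
  otherwise passes to any circle on the other side of the saddle.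
\<close>
lemma saddle_map_mult_X_minus_U:
  assumes fin: "finite S" "finite T" and c: "cS \<in> S" "cT \<in> T"
    and same: "cS \<in> T \<or> cT \<in> S \<Longrightarrow> cS = cT" and M: "M \<subseteq> T"
  shows "saddle_map S T (mult_X_minus_U cS x) M = mult_X_minus_U cT (saddle_map S T x) M"
  using fin
proof (cases rule: saddle_cases)
  case (merge Z a b c)
  have m: "finite Z" "S = insert a (insert b Z)" "T = insert c Z"
     "a \<notin> Z" "b \<notin> Z" "c \<notin> Z" "a \<noteq> b" "c \<noteq> a" "c \<noteq> b"
    using merge by (auto simp: merging_def)
  show ?thesis
  proof (cases "cS \<in> Z")
    case True
    then have [simp]: "cT = cS" using same m by auto
    have ne: "cS \<noteq> a" "cS \<noteq> b" "cS \<noteq> c" using True m by auto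
    obtain K where K: "K \<subseteq> Z" "M = K \<or> M = insert c K"
      using M m by (metis subset_insertE)
    have K': "insert cS K \<subseteq> Z" "K - {cS} \<subseteq> Z" using K True by auto
    show ?thesis
      using K(2) ne m(4-) K(1) K' True
      by (elim disjE; cases "cS \<in> K";
        simp add: mult_X_minus_U_def merge_map[OF merge] insert_commute[of cS a] insert_commute[of cS b]
          insert_commute[of cS c] insert_Diff_if algebra_simps)
  next
    case False
    then have S: "cS = a \<or> cS = b" and T: "cT = c" using c m same by auto
    obtain K where K: "K \<subseteq> Z" "M = K \<or> M = insert c K"
      using M m by (metis subset_insertE)
    have ne: "a \<notin> K" "b \<notin> K" "c \<notin> K" using K m by auto
    show ?thesis
      using K(2) ne m(4-) K(1) S
      by (elim disjE; simp add: T mult_X_minus_U_def merge_map[OF merge] insert_commute[of b a]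
          insert_Diff_if algebra_simps)
  qed
next
  case (split Z a b c)
  have m: "finite Z" "T = insert a (insert b Z)" "S = insert c Z"
     "a \<notin> Z" "b \<notin> Z" "c \<notin> Z" "a \<noteq> b" "c \<noteq> a" "c \<noteq> b"
    using split by (auto simp: merging_def)
  have "\<exists>K. K \<subseteq> Z \<and> (M = K \<or> M = insert a K \<or> M = insert b K \<or> M = insert a (insert b K))"
  proof -
    have "M - {a, b} \<subseteq> Z" using M m by auto
    moreover have "M = M - {a,b} \<or> M = insert a (M - {a,b}) \<or> M = insert b (M - {a,b})
        \<or> M = insert a (insert b (M - {a,b}))" by auto
    ultimately show ?thesis by blast
  qed
  then obtain K where K: "K \<subseteq> Z" "M = K \<or> M = insert a K \<or> M = insert b K \<or> M = insert a (insert b K)"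
    by blast
  have ne: "a \<notin> K" "b \<notin> K" "c \<notin> K" using K m by auto
  show ?thesis
  proof (cases "cS \<in> Z")
    case True
    then have [simp]: "cT = cS" using same m by auto
    have ne': "cS \<noteq> a" "cS \<noteq> b" "cS \<noteq> c" using True m by auto
    have K': "insert cS K \<subseteq> Z" "K - {cS} \<subseteq> Z" using K True by auto
    show ?thesis
      using K(2) ne ne' m(4-) K(1) K' True
      by (elim disjE; cases "cS \<in> K";
        simp add: mult_X_minus_U_def split_map[OF split] insert_commute[of cS a] insert_commute[of cS b]
          insert_commute[of cS c] insert_Diff_if algebra_simps)
  next
    case False
    then have S: "cS = c" and T: "cT = a \<or> cT = b" using c m same by auto
    show ?thesis
      using K(2) ne m(4-) K(1) T
      by (elim disjE; simp add: S mult_X_minus_U_def split_map[OF split] insert_commute[of b a]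
          insert_Diff_if algebra_simps)
  qed
next
  case none
  then show ?thesis by (simp add: saddle_map_eq_zero mult_X_minus_U_def)
qed

section \<open>Homogeneity\<close>

lemma homog_UV_0: "0 \<in> homog_UV d"
  by (simp add: homog_UV_def)

lemma homog_UV_add: "r \<in> homog_UV d \<Longrightarrow> r' \<in> homog_UV d \<Longrightarrow> r + r' \<in> homog_UV d"
  unfolding homog_UV_def by (auto, metis add_0_left)

lemma homog_UV_uminus: "r \<in> homog_UV d \<Longrightarrow> - r \<in> homog_UV d"
  unfolding homog_UV_def by auto

lemma homog_UV_mult:
  assumes "r \<in> homog_UV d" "r' \<in> homog_UV d'"
  shows "r * r' \<in> homog_UV (d + d')"
  unfolding homog_UV_def mem_Collect_eq
proof (intro allI impI)
  fix a b assume "coeff (coeff (r * r') b) a \<noteq> 0"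
  then obtain j where j: "j \<le> b" "coeff (coeff r j * coeff r' (b - j)) a \<noteq> 0"
    unfolding coeff_mult[of r] coeff_sum by (meson atMost_iff sum.neutral)
  then obtain k where k: "k \<le> a" "coeff (coeff r j) k * coeff (coeff r' (b - j)) (a - k) \<noteq> 0"
    unfolding coeff_mult by (meson atMost_iff sum.neutral)
  then have "coeff (coeff r j) k \<noteq> 0" "coeff (coeff r' (b - j)) (a - k) \<noteq> 0" by auto
  then have "d = - 2 * (int k + int j)" "d' = - 2 * (int (a - k) + int (b - j))"
    using assms unfolding homog_UV_def by blast+
  then show "d + d' = - 2 * (int a + int b)" using j k by (simp add: of_nat_diff)
qed

lemma homog_UV_1: "1 \<in> homog_UV 0"
  by (auto simp: homog_UV_def)

lemma homog_UV_U_plus_V: "U + V \<in> homog_UV (- 2)"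
  by (auto simp: homog_UV_def U_def V_def coeff_pCons split: nat.splits)

lemma homog_UV_U: "U \<in> homog_UV (- 2)"
  by (auto simp: homog_UV_def U_def coeff_pCons split: nat.splits)

lemma homog_UV_V: "V \<in> homog_UV (- 2)"
  by (auto simp: homog_UV_def V_def coeff_pCons split: nat.splits)

lemma homog_UV_power: "r \<in> homog_UV d \<Longrightarrow> r ^ k \<in> homog_UV (int k * d)"
  by (induction k) (auto simp: homog_UV_1 algebra_simps dest: homog_UV_mult)

lemma homog_UV_of_int_mult: "r \<in> homog_UV d \<Longrightarrow> of_int m * r \<in> homog_UV d"
proof -
  have "of_int m \<in> homog_UV 0"
    unfolding of_int_poly[symmetric] homog_UV_def
    by (auto simp: of_int_poly coeff_pCons split: nat.splits)
  then show "r \<in> homog_UV d \<Longrightarrow> ?thesis" using homog_UV_mult[of "of_int m" 0 r d] by simp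
qed

lemma homog_UV_sum: "(\<And>k. k \<in> A \<Longrightarrow> h k \<in> homog_UV d) \<Longrightarrow> (\<Sum>k\<in>A. h k) \<in> homog_UV d"
  by (induction A rule: infinite_finite_induct) (auto simp: homog_UV_0 homog_UV_add)

text \<open>
  This is the grading \<open>gr\<close> of the basis element of \<open>A\<^bsup>\<otimes>S\<^esup>\<close> with factors \<open>X\<close> at the circles in \<open>L\<close>.
\<close>
definition tensor_degree :: "'c set \<Rightarrow> 'c set \<Rightarrow> int" where
  "tensor_degree S L = int (card (S - L)) - int (card L)"

lemma tensor_degree_eq: "finite S \<Longrightarrow> L \<subseteq> S \<Longrightarrow> tensor_degree S L = int (card S) - 2 * int (card L)"
  by (simp add: tensor_degree_def card_Diff_subset finite_subset card_mono of_nat_diff)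

definition homogeneous :: "'c set \<Rightarrow> int \<Rightarrow> ('c set \<Rightarrow> 'f::field UV) \<Rightarrow> bool" where
  "homogeneous S d x \<longleftrightarrow> (\<forall>L\<subseteq>S. x L \<in> homog_UV (d - tensor_degree S L))"

text \<open>
  The pairing preserves gradings: a pair \<open>(1, X)\<close> has total grading \<open>1 - 1 = 0\<close>, the grading of
  \<open>\<epsilon>(X) = 1\<close>, and a pair \<open>(X, X)\<close> has total grading \<open>-2\<close>, the grading of \<open>U + V\<close>.
\<close>
lemma frobenius_pairing_homogeneous:
  assumes "finite S" "homogeneous S d x" "homogeneous S d' y"
  shows "frobenius_pairing S x y \<in> homog_UV (d + d')"
  unfolding frobenius_pairing_def
proof (intro homog_UV_sum)
  fix L M assume LM: "L \<in> Pow S" "M \<in> Pow S"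
  show "(if L \<union> M = S then (U + V) ^ card (L \<inter> M) * x L * y M else 0) \<in> homog_UV (d + d')"
  proof (cases "L \<union> M = S")
    case True
    have "card L + card M = card S + card (L \<inter> M)"
      using card_Un_Int[of L M] LM assms(1) True finite_subset by auto
    then have deg: "int (card (L \<inter> M)) * - 2 + (d - tensor_degree S L) + (d' - tensor_degree S M) = d + d'"
      using LM assms(1) by (simp add: tensor_degree_eq)
    have "x L \<in> homog_UV (d - tensor_degree S L)" "y M \<in> homog_UV (d' - tensor_degree S M)"
      using LM assms(2,3) by (auto simp: homogeneous_def)
    then have "(U + V) ^ card (L \<inter> M) * x L * y M \<in>
        homog_UV (int (card (L \<inter> M)) * - 2 + (d - tensor_degree S L) + (d' - tensor_degree S M))"
      by (intro homog_UV_mult homog_UV_power homog_UV_U_plus_V)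
    from this[unfolded deg] show ?thesis using True by simp
  qed (simp add: homog_UV_0)
qed

lemma dual_basis_homogeneous:
  assumes "finite S" "K \<subseteq> S"
  shows "homogeneous S (- tensor_degree S K) (dual_basis S K)"
  unfolding homogeneous_def
proof (intro allI impI)
  fix M assume M: "M \<subseteq> S"
  show "dual_basis S K M \<in> homog_UV (- tensor_degree S K - tensor_degree S M)"
  proof (cases "K \<inter> M = {}")
    case True
    have f: "finite K" "finite M" using assms M finite_subset by auto
    have "int (card (S - (K \<union> M))) = int (card S) - int (card K) - int (card M)"
      using True assms M f card_mono[of S "K \<union> M"]
      by (simp add: card_Diff_subset card_Un_disjoint of_nat_diff)
    then have "- tensor_degree S K - tensor_degree S M = int (card (S - (K \<union> M))) * - 2"
      using assms M by (simp add: tensor_degree_eq)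
    then show ?thesis
      using True homog_UV_power[OF homog_UV_uminus[OF homog_UV_U_plus_V], of "card (S - (K \<union> M))"]
      by (simp add: dual_basis_def)
  qed (simp add: dual_basis_def homog_UV_0)
qed

lemma mult_X_minus_U_homogeneous:
  assumes "finite S" "c \<in> S" "homogeneous S d x"
  shows "homogeneous S (d - 2) (mult_X_minus_U c x)"
  unfolding homogeneous_def
proof (intro allI impI)
  fix M assume M: "M \<subseteq> S"
  have f: "finite M" using assms M finite_subset by auto
  have x: "x L \<in> homog_UV (d - tensor_degree S L)" if "L \<subseteq> S" for L
    using that assms by (auto simp: homogeneous_def)
  have scale: "r * x L \<in> homog_UV e"
    if "L \<subseteq> S" "r \<in> homog_UV k" "e = k + (d - tensor_degree S L)" for L r k e
    using homog_UV_mult[OF that(2) x[OF that(1)]] that(3) by simp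
  show "mult_X_minus_U c x M \<in> homog_UV (d - 2 - tensor_degree S M)"
  proof (cases "c \<in> M")
    case True
    then have "card M = Suc (card (M - {c}))" using f by (metis card_Suc_Diff1)
    then have "tensor_degree S (M - {c}) = tensor_degree S M + 2"
      using M assms(1) by (subst (1 2) tensor_degree_eq) auto
    then have "x (M - {c}) \<in> homog_UV (d - 2 - tensor_degree S M)"
      using x[of "M - {c}"] M by (auto simp: algebra_simps)
    moreover have "V * x M \<in> homog_UV (d - 2 - tensor_degree S M)"
      by (rule scale[OF M homog_UV_V]) simp
    ultimately show ?thesis using True by (simp add: mult_X_minus_U_def homog_UV_add)
  next
    case False
    have "tensor_degree S (insert c M) = tensor_degree S M - 2"
      using M assms(1,2) False f by (subst (1 2) tensor_degree_eq) auto
    then have "(U * V) * x (insert c M) \<in> homog_UV (d - 2 - tensor_degree S M)"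
      using M assms(2) by (intro scale[OF _ homog_UV_mult[OF homog_UV_U homog_UV_V]]) auto
    moreover have "U * x M \<in> homog_UV (d - 2 - tensor_degree S M)"
      by (rule scale[OF M homog_UV_U]) simp
    moreover have "mult_X_minus_U c x M = - (U * x M + (U * V) * x (insert c M))"
      using False by (simp add: mult_X_minus_U_def algebra_simps)
    ultimately show ?thesis by (metis homog_UV_add homog_UV_uminus)
  qed
qed

lemma div_X_minus_U_homogeneous:
  assumes "finite S" "c \<in> S" "homogeneous S d x"
  shows "homogeneous S (d + 2) (div_X_minus_U c x)"
  unfolding homogeneous_def
proof (intro allI impI)
  fix M assume M: "M \<subseteq> S"
  show "div_X_minus_U c x M \<in> homog_UV (d + 2 - tensor_degree S M)"
  proof (cases "c \<in> M")
    case True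
    then show ?thesis by (simp add: div_X_minus_U_def homog_UV_0)
  next
    case False
    have "finite M" using assms M finite_subset by auto
    then have deg: "d + 2 - tensor_degree S M = d - tensor_degree S (insert c M)"
      using M assms(1,2) False by (subst (1 2) tensor_degree_eq) auto
    show ?thesis
      unfolding deg using False M assms by (simp add: homogeneous_def div_X_minus_U_def)
  qed
qed

section \<open>Comparing sign assignments\<close>

lemma sign_assignment_values:
  assumes "sign_assignment n s" "I \<subseteq> {..<n}" "i < n" "i \<notin> I"
  shows "s I i \<in> {1, - 1}"
  using assms(1)[unfolded sign_assignment_def, THEN conjunct1, rule_format, of I i] assms by simp

lemma sign_assignment_anticommute:
  assumes "sign_assignment n s" "I \<subseteq> {..<n}" "i < n" "j < n" "i \<notin> I" "j \<notin> I" "i \<noteq> j"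
  shows "s I i * s (insert i I) j = - (s I j * s (insert j I) i)"
  using assms(1)[unfolded sign_assignment_def, THEN conjunct2, rule_format, of I i j] assms by simp

text \<open>
  The product of two sign assignments is a multiplicative 1-cocycle on the cube, and the cube has no
  cohomology in degree one. The cochain \<open>\<eta>\<close> is found by multiplying the values of the cocycle along the
  path from the empty set to \<open>I\<close> that adds the elements in increasing order; commutativity of the
  squares makes it independent of the path.
\<close>
lemma sign_assignments_cohomologous:
  assumes s: "sign_assignment n s" and t: "sign_assignment n t"
  obtains \<eta> :: "nat set \<Rightarrow> int" where
    "\<And>I. I \<subseteq> {..<n} \<Longrightarrow> \<eta> I * \<eta> I = 1"
    "\<And>I i. I \<subseteq> {..<n} \<Longrightarrow> i < n \<Longrightarrow> i \<notin> I \<Longrightarrow> \<eta> (insert i I) * s I i = \<eta> I * t I i"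
proof -
  define c where "c I i = s I i * t I i" for I i
  have unit: "s I i * s I i = 1" "t I i * t I i = 1" if "I \<subseteq> {..<n}" "i < n" "i \<notin> I" for I i
  proof -
    have "s I i \<in> {1, - 1}" "t I i \<in> {1, - 1}"
      using sign_assignment_values s t that by metis+
    then show "s I i * s I i = 1" "t I i * t I i = 1" by auto
  qed
  have comm: "c I i * c (insert i I) j = c I j * c (insert j I) i"
    if "I \<subseteq> {..<n}" "i < n" "j < n" "i \<notin> I" "j \<notin> I" "i \<noteq> j" for I i j
  proof -
    have "c I i * c (insert i I) j = (s I i * s (insert i I) j) * (t I i * t (insert i I) j)"
      by (simp add: c_def mult_ac)
    also have "\<dots> = (- (s I j * s (insert j I) i)) * (- (t I j * t (insert j I) i))"
      unfolding sign_assignment_anticommute[OF s that] sign_assignment_anticommute[OF t that] ..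
    finally show ?thesis by (simp add: c_def mult_ac)
  qed
  define \<eta> where "\<eta> I = (\<Prod>j\<in>I. c (I \<inter> {..<j}) j)" for I
  \<comment> \<open>The last edge of the increasing path; the other edges are handled by pushing them below it.\<close>
  have top: "\<eta> (insert m I) = \<eta> I * c I m" if "finite I" "\<forall>j\<in>I. j < m" for I m
  proof -
    have "(\<Prod>j\<in>I. c (insert m I \<inter> {..<j}) j) = \<eta> I"
      unfolding \<eta>_def using that(2) by (intro prod.cong refl arg_cong2[where f=c]) auto
    moreover have "insert m I \<inter> {..<m} = I" "m \<notin> I" using that(2) by auto
    ultimately show ?thesis using that(1) by (simp add: \<eta>_def)
  qed
  have step: "\<eta> (insert i I) = \<eta> I * c I i" if "I \<subseteq> {..<n}" "i < n" "i \<notin> I" for I i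
  proof -
    have "finite I" using that(1) finite_subset by blast
    then show ?thesis using that
    proof (induction I rule: finite_linorder_max_induct)
      case empty
      then show ?case using top[of "{}"] by simp
    next
      case (insert m I)
      show ?case
      proof (cases "m < i")
        case True
        then show ?thesis using insert.hyps by (intro top) auto
      next
        case False
        then have "i < m" using insert.prems by auto
        then have "\<eta> (insert i (insert m I)) = \<eta> (insert i I) * c (insert i I) m"
          using insert.hyps insert_commute[of i m I] top[of "insert i I" m] by auto
        also have "\<dots> = \<eta> I * (c I i * c (insert i I) m)" using insert by simp
        also have "\<dots> = \<eta> I * (c I m * c (insert m I) i)"
          using insert.prems insert.hyps \<open>i < m\<close> by (subst comm) auto
        also have "\<dots> = \<eta> (insert m I) * c (insert m I) i" using top insert.hyps by simp
        finally show ?thesis .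
      qed
    qed
  qed
  show ?thesis
  proof
    fix I assume I: "I \<subseteq> {..<n}"
    have "c (I \<inter> {..<j}) j * c (I \<inter> {..<j}) j = 1" if "j \<in> I" for j
    proof -
      let ?J = "I \<inter> {..<j}"
      have J: "?J \<subseteq> {..<n}" "j < n" "j \<notin> ?J" using that I by auto
      have "(s ?J j * s ?J j) * (t ?J j * t ?J j) = 1" by (simp only: unit[OF J] mult_1)
      then show ?thesis by (simp add: c_def mult_ac)
    qed
    then show "\<eta> I * \<eta> I = 1" unfolding \<eta>_def prod.distrib[symmetric] by simp
  next
    fix I i assume *: "I \<subseteq> {..<n}" "i < n" "i \<notin> I"
    have "\<eta> (insert i I) * s I i = \<eta> I * t I i * (s I i * s I i)"
      by (simp only: step[OF *] c_def mult_ac)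
    then show "\<eta> (insert i I) * s I i = \<eta> I * t I i" by (simp only: unit[OF *] mult_1_right)
  qed
qed

text \<open>
  Passing to complements turns the edge from \<open>I\<close> to \<open>insert i I\<close> of the cube of a diagram into the edge
  from \<open>{..<n} - insert i I\<close> to \<open>{..<n} - I\<close> of the cube of the mirror image, with reversed direction.
\<close>
lemma sign_assignment_complement:
  assumes "sign_assignment n s"
  shows "sign_assignment n (\<lambda>I i. s ({..<n} - insert i I) i)"
  unfolding sign_assignment_def
proof (intro conjI allI impI)
  fix I i assume "I \<subseteq> {..<n} \<and> i < n \<and> i \<notin> I"
  then show "s ({..<n} - insert i I) i \<in> {1, - 1}"
    by (intro sign_assignment_values[OF assms]) auto
next
  fix I i j assume a: "I \<subseteq> {..<n} \<and> i < n \<and> j < n \<and> i \<notin> I \<and> j \<notin> I \<and> i \<noteq> j"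
  define K where "K = {..<n} - insert i (insert j I)"
  have K: "{..<n} - insert i I = insert j K" "{..<n} - insert j I = insert i K"
    "{..<n} - insert j (insert i I) = K" "{..<n} - insert i (insert j I) = K"
    using a by (auto simp: K_def)
  have "s K i * s (insert i K) j = - (s K j * s (insert j K) i)"
    using a by (intro sign_assignment_anticommute[OF assms]) (auto simp: K_def)
  then show "s ({..<n} - insert i I) i * s ({..<n} - insert j (insert i I)) j =
      - (s ({..<n} - insert j I) j * s ({..<n} - insert i (insert j I)) i)"
    unfolding K by (simp add: mult_ac)
qed

section \<open>Circles\<close>

lemma equiv_equiv_closure: "equiv UNIV (equiv_closure r)"
  unfolding equiv_closure_def
  by (intro equivI refl_rtrancl trans_rtrancl sym_rtrancl sym_Un_converse) auto

lemma finite_circles: "finite (arcs D) \<Longrightarrow> finite (circles D I)"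
  unfolding circles_def quotient_def by simp

lemma circle_at_unique:
  assumes "c \<in> circles D I" "p \<in> c"
  shows "circle_at D I p = c"
  unfolding circle_at_def
proof (rule the_equality)
  fix c' assume c': "c' \<in> circles D I \<and> p \<in> c'"
  have "c'' = equiv_closure (\<Union>i<n_cross D. smoothing (i \<in> I) (crossings D ! i)) `` {p}"
    if "c'' \<in> circles D I" "p \<in> c''" for c''
    using that(1) unfolding circles_def
  proof (rule quotientE)
    fix x assume *: "c'' = equiv_closure (\<Union>i<n_cross D. smoothing (i \<in> I) (crossings D ! i)) `` {x}"
    show ?thesis using that(2) unfolding * by (intro equiv_class_eq[OF equiv_equiv_closure]) simp
  qed
  from this[of c] this[of c'] assms c' show "c' = c" by simp
qed (use assms in simp)

lemma circle_at_mem: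
  assumes "p \<in> arcs D"
  shows "circle_at D I p \<in> circles D I" "p \<in> circle_at D I p"
proof -
  let ?r = "equiv_closure (\<Union>i<n_cross D. smoothing (i \<in> I) (crossings D ! i))"
  have c: "?r `` {p} \<in> circles D I" using assms unfolding circles_def by (rule quotientI)
  have p: "p \<in> ?r `` {p}"
    using equiv_equiv_closure by (rule equiv_class_self) simp
  show "circle_at D I p \<in> circles D I" "p \<in> circle_at D I p"
    using c p unfolding circle_at_unique[OF c p] .
qed

lemma n_cross_mirror [simp]: "n_cross (mirror D) = n_cross D"
  by (simp add: n_cross_def mirror_def)

lemma arcs_mirror [simp]: "arcs (mirror D) = arcs D"
  by (simp add: mirror_def)

lemma csign_mirror_crossing: "csign (mirror_crossing c) = Pos \<longleftrightarrow> csign c = Neg"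
  "csign (mirror_crossing c) = Neg \<longleftrightarrow> csign c = Pos"
  by (cases c rule: mirror_crossing.cases; simp)+

lemma n_pos_mirror [simp]: "n_pos (mirror D) = n_neg D"
  by (simp add: n_pos_def n_neg_def mirror_def filter_map o_def csign_mirror_crossing)

lemma n_neg_mirror [simp]: "n_neg (mirror D) = n_pos D"
  by (simp add: n_pos_def n_neg_def mirror_def filter_map o_def csign_mirror_crossing)

lemma n_pos_plus_n_neg: "n_pos D + n_neg D = n_cross D"
proof -
  have "csign c = Neg \<longleftrightarrow> csign c \<noteq> Pos" for c :: "'a crossing" by (cases "csign c") auto
  then show ?thesis
    unfolding n_pos_def n_neg_def n_cross_def using sum_length_filter_compl[of "\<lambda>c. csign c = Pos" "crossings D"]
    by simp
qed

text \<open>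
  The two smoothings of a crossing are exchanged when the crossing is switched. The pairs of arcs may
  appear in the other order, which is irrelevant after symmetrization.
\<close>
lemma smoothing_mirror_crossing:
  "smoothing (\<not> b) (mirror_crossing c) \<union> (smoothing (\<not> b) (mirror_crossing c))\<inverse> =
   smoothing b c \<union> (smoothing b c)\<inverse>"
  by (cases c rule: mirror_crossing.cases; cases b) auto

lemma circles_mirror:
  assumes "I \<subseteq> {..<n_cross D}"
  shows "circles (mirror D) ({..<n_cross D} - I) = circles D I"
proof -
  let ?r = "\<lambda>D I i. smoothing (i \<in> I) (crossings D ! i)"
  let ?n = "n_cross D"
  have *: "?r (mirror D) ({..<?n} - I) i \<union> (?r (mirror D) ({..<?n} - I) i)\<inverse> = ?r D I i \<union> (?r D I i)\<inverse>"
    if "i < ?n" for i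
  proof -
    have "crossings (mirror D) ! i = mirror_crossing (crossings D ! i)"
      using that by (simp add: mirror_def n_cross_def)
    moreover have "(i \<in> {..<?n} - I) = (\<not> i \<in> I)" using that by auto
    ultimately show ?thesis by (simp only: smoothing_mirror_crossing)
  qed
  have "(\<Union>i<?n. ?r (mirror D) ({..<?n} - I) i \<union> (?r (mirror D) ({..<?n} - I) i)\<inverse>) =
      (\<Union>i<?n. ?r D I i \<union> (?r D I i)\<inverse>)"
    by (rule SUP_cong[OF refl], rule *) simp
  then have "equiv_closure (\<Union>i<?n. ?r (mirror D) ({..<?n} - I) i) = equiv_closure (\<Union>i<?n. ?r D I i)"
    unfolding equiv_closure_def converse_UNION UN_Un_distrib by simp
  then show ?thesis unfolding circles_def by simp
qed

lemma circles_mirror':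
  assumes "I \<subseteq> {..<n_cross D}"
  shows "circles (mirror D) I = circles D ({..<n_cross D} - I)"
  using circles_mirror[of "{..<n_cross D} - I" D] assms by (simp add: double_diff)

lemma circle_at_mirror:
  assumes "I \<subseteq> {..<n_cross D}"
  shows "circle_at (mirror D) ({..<n_cross D} - I) p = circle_at D I p"
  unfolding circle_at_def by (simp add: circles_mirror[OF assms])

section \<open>The maps of the complex at the vertices of the cube\<close>

definition vertex :: "('e state \<Rightarrow> 'r) \<Rightarrow> nat set \<Rightarrow> 'e set set \<Rightarrow> 'r" where
  "vertex x I L = x (I, L)"

lemma states_iff: "(I, L) \<in> states D \<longleftrightarrow> I \<subseteq> {..<n_cross D} \<and> L \<subseteq> circles D I"
  by (simp add: states_def)

lemma saddle_map_cong:
  "(\<And>L. L \<subseteq> S \<Longrightarrow> x L = y L) \<Longrightarrow> saddle_map S T x M = saddle_map S T y M"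
  unfolding saddle_map_def by (intro sum.cong) auto

lemma vertex_CKh_dif:
  assumes "J \<subseteq> {..<n_cross D}" "M \<subseteq> circles D J"
  shows "vertex (CKh_dif s D x) J M =
    (\<Sum>i\<in>J. of_int (s (J - {i}) i) *
      saddle_map (circles D (J - {i})) (circles D J) (vertex x (J - {i})) M)"
  using assms
  by (simp add: vertex_def CKh_dif_def states_iff saddle_map_def sum_distrib_left mult_ac)

text \<open>
  The matrix of the basepoint map has at most two nonzero entries in each row, namely at the labellings that
  agree with \<open>M\<close> outside the circle through \<open>p\<close>.
\<close>
lemma vertex_basepoint_map:
  fixes x :: "'e state \<Rightarrow> 'f::field UV"
  assumes "finite (arcs D)" "p \<in> arcs D" "I \<subseteq> {..<n_cross D}" "M \<subseteq> circles D I"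
  shows "vertex (basepoint_map D p x) I M = mult_X_minus_U (circle_at D I p) (vertex x I) M"
proof -
  define c where "c = circle_at D I p"
  define Z where "Z = circles D I - {c}"
  have Z: "circles D I = insert c Z" "finite Z" "c \<notin> Z"
    using circle_at_mem[OF assms(2)] finite_circles[OF assms(1)] by (auto simp: Z_def c_def)
  define h :: "'e set set \<Rightarrow> 'f UV" where "h L = (if L - {c} = M - {c}
      then mult_coeff True (c \<in> L) (c \<in> M) - U * mult_coeff False (c \<in> L) (c \<in> M) else 0) * x (I, L)"
    for L
  define a :: "'f UV" where "a =
      (mult_coeff True False (c \<in> M) - U * mult_coeff False False (c \<in> M)) * x (I, M - {c})
    + (mult_coeff True True (c \<in> M) - U * mult_coeff False True (c \<in> M)) * x (I, insert c (M - {c}))"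
  have "vertex (basepoint_map D p x) I M = (\<Sum>L\<in>Pow (insert c Z). h L)"
    using assms(3,4) unfolding vertex_def basepoint_map_def c_def[symmetric] Z(1)[symmetric] h_def
    by (simp add: states_iff Let_def c_def[symmetric])
  also have "\<dots> = (\<Sum>L\<in>Pow Z. if L = M - {c} then a else 0)"
    unfolding sum_Pow_insert[OF Z(2,3)]
  proof (intro sum.cong refl)
    fix L assume "L \<in> Pow Z"
    then have "c \<notin> L" using Z by auto
    then show "h L + h (insert c L) = (if L = M - {c} then a else 0)"
      by (auto simp: h_def a_def)
  qed
  also have "\<dots> = a"
  proof -
    have "M - {c} \<in> Pow Z" using assms(4) Z by auto
    then show ?thesis using Z by simp
  qed
  also have "a = mult_X_minus_U c (vertex x I) M"
    by (cases "c \<in> M") (auto simp: a_def mult_X_minus_U_def vertex_def insert_absorb algebra_simps)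
  finally show ?thesis by (simp add: c_def)
qed

lemma basepoint_map_outside: "k \<notin> states D \<Longrightarrow> basepoint_map D p x k = 0"
  by (cases k) (simp add: basepoint_map_def)

lemma CKh_dif_outside: "k \<notin> states D \<Longrightarrow> CKh_dif s D x k = 0"
  by (cases k) (simp add: CKh_dif_def)

lemma mult_X_minus_U_cong:
  assumes "c \<in> S" "M \<subseteq> S" "\<And>L. L \<subseteq> S \<Longrightarrow> x L = y L"
  shows "mult_X_minus_U c x M = mult_X_minus_U c y M"
proof -
  have "x M = y M" "x (M - {c}) = y (M - {c})" "x (insert c M) = y (insert c M)"
    using assms(1,2) by (auto intro!: assms(3))
  then show ?thesis by (simp add: mult_X_minus_U_def)
qed

lemma mult_X_minus_U_sum:
  "mult_X_minus_U c (\<lambda>M. \<Sum>i\<in>A. r i * x i M) M = (\<Sum>i\<in>A. r i * mult_X_minus_U c (x i) M)"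
  by (simp add: mult_X_minus_U_def sum_distrib_left sum.distrib[symmetric] algebra_simps
      sum_negf[symmetric] flip: sum_subtractf)

text \<open>
  Along an edge of the cube, the circle through \<open>p\<close> either does not meet the saddle, and then it is the
  circle through \<open>p\<close> on both sides, or it meets the saddle, and then so does the circle through \<open>p\<close> on
  the other side. In both cases multiplication by \<open>X - U\<close> commutes with the saddle map.
\<close>
lemma basepoint_map_commutes:
  fixes x :: "'e state \<Rightarrow> 'f::field UV"
  assumes fin: "finite (arcs D)" and p: "p \<in> arcs D"
  shows "basepoint_map D p (CKh_dif s D x) = CKh_dif s D (basepoint_map D p x)"
proof (rule ext)
  fix k :: "'e state"
  obtain J M where k: "k = (J, M)" by (cases k)
  show "basepoint_map D p (CKh_dif s D x) k = CKh_dif s D (basepoint_map D p x) k"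
  proof (cases "k \<in> states D")
    case False
    then show ?thesis by (simp add: basepoint_map_outside CKh_dif_outside)
  next
    case True
    then have JM: "J \<subseteq> {..<n_cross D}" "M \<subseteq> circles D J" by (simp_all add: k states_iff)
    let ?c = "\<lambda>I. circle_at D I p" and ?S = "circles D"
    let ?r = "\<lambda>i. of_int (s (J - {i}) i) :: 'f UV"
    have "vertex (basepoint_map D p (CKh_dif s D x)) J M =
        mult_X_minus_U (?c J) (vertex (CKh_dif s D x) J) M"
      by (rule vertex_basepoint_map[OF fin p JM])
    also have "\<dots> = mult_X_minus_U (?c J)
        (\<lambda>M. \<Sum>i\<in>J. ?r i * saddle_map (?S (J - {i})) (?S J) (vertex x (J - {i})) M) M"
      by (rule mult_X_minus_U_cong[OF circle_at_mem(1)[OF p] JM(2)]) (rule vertex_CKh_dif[OF JM(1)])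
    also have "\<dots> = (\<Sum>i\<in>J. ?r i *
        mult_X_minus_U (?c J) (saddle_map (?S (J - {i})) (?S J) (vertex x (J - {i}))) M)"
      by (rule mult_X_minus_U_sum)
    also have "\<dots> = (\<Sum>i\<in>J. ?r i *
        saddle_map (?S (J - {i})) (?S J) (vertex (basepoint_map D p x) (J - {i})) M)"
    proof (intro sum.cong refl arg_cong2[where f="(*)"])
      fix i assume "i \<in> J"
      have J': "J - {i} \<subseteq> {..<n_cross D}" using JM by auto
      have same: "?c (J - {i}) = ?c J" if "?c (J - {i}) \<in> ?S J \<or> ?c J \<in> ?S (J - {i})"
        using that
      proof
        assume "?c (J - {i}) \<in> ?S J"
        then show ?thesis using circle_at_unique circle_at_mem(2)[OF p] by metis
      next
        assume "?c J \<in> ?S (J - {i})"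
        then show ?thesis using circle_at_unique circle_at_mem(2)[OF p] by metis
      qed
      have "mult_X_minus_U (?c J) (saddle_map (?S (J - {i})) (?S J) (vertex x (J - {i}))) M =
        saddle_map (?S (J - {i})) (?S J) (mult_X_minus_U (?c (J - {i})) (vertex x (J - {i}))) M"
        by (rule saddle_map_mult_X_minus_U[symmetric])
          (use finite_circles[OF fin] circle_at_mem(1)[OF p] same JM(2) in auto)
      also have "\<dots> = saddle_map (?S (J - {i})) (?S J) (vertex (basepoint_map D p x) (J - {i})) M"
        by (rule saddle_map_cong) (rule vertex_basepoint_map[OF fin p J', symmetric])
      finally show "mult_X_minus_U (?c J) (saddle_map (?S (J - {i})) (?S J) (vertex x (J - {i}))) M =
        saddle_map (?S (J - {i})) (?S J) (vertex (basepoint_map D p x) (J - {i})) M" .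
    qed
    also have "\<dots> = vertex (CKh_dif s D (basepoint_map D p x)) J M"
      by (rule vertex_CKh_dif[OF JM, symmetric])
    finally show ?thesis by (simp add: k vertex_def)
  qed
qed

text \<open>
  This is a right inverse of the basepoint map on its image, linear but in general not a chain map. It selects a
  representative \<open>x\<close> of an element \<open>f\<^sub>p x\<close> of the reduced complex.
\<close>
definition basepoint_section ::
    "'e diagram \<Rightarrow> 'e \<Rightarrow> ('e state \<Rightarrow> 'f::field UV) \<Rightarrow> 'e state \<Rightarrow> 'f UV" where
  "basepoint_section D p z = (\<lambda>(I, L).
     if (I, L) \<in> states D then div_X_minus_U (circle_at D I p) (vertex z I) L else 0)"

lemma vertex_basepoint_section:
  "I \<subseteq> {..<n_cross D} \<Longrightarrow> L \<subseteq> circles D I \<Longrightarrow>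
   vertex (basepoint_section D p z) I L = div_X_minus_U (circle_at D I p) (vertex z I) L"
  by (simp add: vertex_def basepoint_section_def states_iff)

lemma div_X_minus_U_cong:
  assumes "c \<in> S" "M \<subseteq> S" "\<And>L. L \<subseteq> S \<Longrightarrow> x L = y L"
  shows "div_X_minus_U c x M = div_X_minus_U c y M"
  using assms by (simp add: div_X_minus_U_def)

lemma basepoint_map_section:
  fixes x :: "'e state \<Rightarrow> 'f::field UV"
  assumes fin: "finite (arcs D)" and p: "p \<in> arcs D"
  shows "basepoint_map D p (basepoint_section D p (basepoint_map D p x)) = basepoint_map D p x"
proof (rule ext)
  fix k :: "'e state"
  obtain I M where k: "k = (I, M)" by (cases k)
  show "basepoint_map D p (basepoint_section D p (basepoint_map D p x)) k = basepoint_map D p x k"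
  proof (cases "k \<in> states D")
    case False
    then show ?thesis by (simp add: basepoint_map_outside)
  next
    case True
    then have IM: "I \<subseteq> {..<n_cross D}" "M \<subseteq> circles D I" by (simp_all add: k states_iff)
    let ?c = "circle_at D I p"
    note c = circle_at_mem(1)[OF p, of I]
    have "vertex (basepoint_map D p (basepoint_section D p (basepoint_map D p x))) I M =
        mult_X_minus_U ?c (vertex (basepoint_section D p (basepoint_map D p x)) I) M"
      by (rule vertex_basepoint_map[OF fin p IM])
    also have "\<dots> = mult_X_minus_U ?c (div_X_minus_U ?c (mult_X_minus_U ?c (vertex x I))) M"
    proof (rule mult_X_minus_U_cong[OF c IM(2)])
      fix L assume L: "L \<subseteq> circles D I"
      show "vertex (basepoint_section D p (basepoint_map D p x)) I L =
          div_X_minus_U ?c (mult_X_minus_U ?c (vertex x I)) L"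
        unfolding vertex_basepoint_section[OF IM(1) L]
        by (rule div_X_minus_U_cong[OF c L]) (rule vertex_basepoint_map[OF fin p IM(1)])
    qed
    also have "\<dots> = vertex (basepoint_map D p x) I M"
      unfolding mult_div_mult_X_minus_U by (rule vertex_basepoint_map[OF fin p IM, symmetric])
    finally show ?thesis by (simp add: k vertex_def)
  qed
qed

lemma CKh_chain_iff:
  "x \<in> CKh_chain D i \<longleftrightarrow> (\<forall>I L. x (I, L) \<noteq> 0 \<longrightarrow>
     I \<subseteq> {..<n_cross D} \<and> L \<subseteq> circles D I \<and> int (card I) = i + int (n_neg D))"
  by (force simp: CKh_chain_def states_iff hgr_def)

lemma CKh_chain_zero: "(\<lambda>k. 0) \<in> CKh_chain D i"
  by (simp add: CKh_chain_def)

lemma CKh_chain_add: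
  "x \<in> CKh_chain D i \<Longrightarrow> y \<in> CKh_chain D i \<Longrightarrow> (\<lambda>k. x k + y k) \<in> CKh_chain D i"
proof -
  assume *: "x \<in> CKh_chain D i" "y \<in> CKh_chain D i"
  have "x k \<noteq> 0 \<or> y k \<noteq> 0" if "x k + y k \<noteq> 0" for k using that by auto
  then show ?thesis using * unfolding CKh_chain_def by blast
qed

lemma CKh_chain_scale: "x \<in> CKh_chain D i \<Longrightarrow> (\<lambda>k. r * x k) \<in> CKh_chain D i"
  unfolding CKh_chain_def by auto

lemma CKh_dif_in_chain:
  assumes "x \<in> CKh_chain D i"
  shows "CKh_dif s D x \<in> CKh_chain D (i + 1)"
  unfolding CKh_chain_iff
proof (intro allI impI)
  fix J M assume nz: "CKh_dif s D x (J, M) \<noteq> 0"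
  then have st: "(J, M) \<in> states D" using CKh_dif_outside by metis
  then have JM: "J \<subseteq> {..<n_cross D}" "M \<subseteq> circles D J" by (simp_all add: states_iff)
  have "\<exists>j\<in>J. \<exists>L. x (J - {j}, L) \<noteq> 0"
  proof (rule ccontr)
    assume "\<not> ?thesis"
    then have "CKh_dif s D x (J, M) = 0" by (simp add: CKh_dif_def)
    then show False using nz by simp
  qed
  then obtain j L where j: "j \<in> J" "x (J - {j}, L) \<noteq> 0" by blast
  have "int (card (J - {j})) = i + int (n_neg D)"
    using assms j(2) unfolding CKh_chain_iff by blast
  moreover have "card J = Suc (card (J - {j}))"
    using j(1) JM(1) finite_subset by (metis card_Suc_Diff1 finite_lessThan)
  ultimately show "J \<subseteq> {..<n_cross D} \<and> M \<subseteq> circles D J \<and> int (card J) = i + 1 + int (n_neg D)"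
    using JM by simp
qed

lemma basepoint_map_in_chain:
  assumes "x \<in> CKh_chain D i"
  shows "basepoint_map D p x \<in> CKh_chain D i"
  unfolding CKh_chain_iff
proof (intro allI impI)
  fix I M assume nz: "basepoint_map D p x (I, M) \<noteq> 0"
  then have "(I, M) \<in> states D" using basepoint_map_outside by metis
  moreover have "\<exists>L. x (I, L) \<noteq> 0"
  proof (rule ccontr)
    assume "\<not> ?thesis"
    then have "basepoint_map D p x (I, M) = 0" by (simp add: basepoint_map_def)
    then show False using nz by simp
  qed
  then have "int (card I) = i + int (n_neg D)"
    using assms unfolding CKh_chain_iff by blast
  ultimately show "I \<subseteq> {..<n_cross D} \<and> M \<subseteq> circles D I \<and> int (card I) = i + int (n_neg D)"
    by (simp add: states_iff)
qed

lemma basepoint_section_in_chain: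
  assumes "x \<in> CKh_chain D i"
  shows "basepoint_section D p x \<in> CKh_chain D i"
  unfolding CKh_chain_iff
proof (intro allI impI)
  fix I M assume nz: "basepoint_section D p x (I, M) \<noteq> 0"
  then have "(I, M) \<in> states D" by (auto simp: basepoint_section_def split: if_splits)
  moreover have "x (I, insert (circle_at D I p) M) \<noteq> 0"
    using nz by (auto simp: basepoint_section_def div_X_minus_U_def vertex_def split: if_splits)
  then have "int (card I) = i + int (n_neg D)"
    using assms unfolding CKh_chain_iff by blast
  ultimately show "I \<subseteq> {..<n_cross D} \<and> M \<subseteq> circles D I \<and> int (card I) = i + int (n_neg D)"
    by (simp add: states_iff)
qed

lemma basepoint_map_add:
  "basepoint_map D p (\<lambda>k. x k + y k) = (\<lambda>k. basepoint_map D p x k + basepoint_map D p y k)"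
  by (rule ext) (auto simp: basepoint_map_def algebra_simps sum.distrib Let_def split: prod.splits)

lemma basepoint_map_scale:
  "basepoint_map D p (\<lambda>k. r * x k) = (\<lambda>k. r * basepoint_map D p x k)"
  by (rule ext) (auto simp: basepoint_map_def sum_distrib_left mult_ac split: prod.splits)

lemma basepoint_section_add:
  "basepoint_section D p (\<lambda>k. x k + y k) = (\<lambda>k. basepoint_section D p x k + basepoint_section D p y k)"
  by (rule ext) (auto simp: basepoint_section_def div_X_minus_U_def vertex_def split: prod.splits)

lemma basepoint_section_scale:
  "basepoint_section D p (\<lambda>k. r * x k) = (\<lambda>k. r * basepoint_section D p x k)"
  by (rule ext) (auto simp: basepoint_section_def div_X_minus_U_def vertex_def split: prod.splits)

section \<open>The pairing between the complexes of a diagram and its mirror image\<close>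

text \<open>
  The \<open>I\<close>-smoothing of \<open>D\<close> consists of the same circles as the smoothing of the mirror image at the
  complement of \<open>I\<close>, and the pairing matches these two vertices. The signs \<open>\<eta>\<close> account for the
  choice of the signs in the two cubes.
\<close>
definition cube_pairing ::
    "(nat set \<Rightarrow> int) \<Rightarrow> 'e diagram \<Rightarrow> ('e state \<Rightarrow> 'f::field UV) \<Rightarrow> ('e state \<Rightarrow> 'f UV) \<Rightarrow> 'f UV" where
  "cube_pairing \<eta> D x y = (\<Sum>I\<in>Pow {..<n_cross D}. of_int (\<eta> I) *
     frobenius_pairing (circles D I) (vertex x I) (vertex y ({..<n_cross D} - I)))"

lemma vertex_add: "vertex (\<lambda>k. x k + y k) I = (\<lambda>L. vertex x I L + vertex y I L)"
  by (simp add: vertex_def fun_eq_iff)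

lemma vertex_scale: "vertex (\<lambda>k. r * x k) I = (\<lambda>L. r * vertex x I L)"
  by (simp add: vertex_def fun_eq_iff)

lemma cube_pairing_linear:
  "cube_pairing \<eta> D (\<lambda>k. x k + x' k) y = cube_pairing \<eta> D x y + cube_pairing \<eta> D x' y"
  "cube_pairing \<eta> D (\<lambda>k. r * x k) y = r * cube_pairing \<eta> D x y"
  "cube_pairing \<eta> D x (\<lambda>k. y k + y' k) = cube_pairing \<eta> D x y + cube_pairing \<eta> D x y'"
  "cube_pairing \<eta> D x (\<lambda>k. r * y k) = r * cube_pairing \<eta> D x y"
  by (simp_all add: cube_pairing_def vertex_add vertex_scale frobenius_pairing_linear
      sum.distrib sum_distrib_left algebra_simps)

lemma cube_pairing_basepoint_map:
  assumes fin: "finite (arcs D)" and p: "p \<in> arcs D"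
  shows "cube_pairing \<eta> D (basepoint_map D p x) y = cube_pairing \<eta> D x (basepoint_map (mirror D) p y)"
  unfolding cube_pairing_def
proof (intro sum.cong refl arg_cong2[where f="(*)"])
  fix I assume "I \<in> Pow {..<n_cross D}"
  then have I: "I \<subseteq> {..<n_cross D}" by simp
  let ?I' = "{..<n_cross D} - I"
  let ?S = "circles D I" and ?c = "circle_at D I p"
  have "frobenius_pairing ?S (vertex (basepoint_map D p x) I) (vertex y ?I') =
      frobenius_pairing ?S (mult_X_minus_U ?c (vertex x I)) (vertex y ?I')"
    by (rule frobenius_pairing_cong) (simp_all add: vertex_basepoint_map[OF fin p I])
  also have "\<dots> = frobenius_pairing ?S (vertex x I) (mult_X_minus_U ?c (vertex y ?I'))"
    by (rule mult_X_minus_U_self_adjoint[OF finite_circles[OF fin] circle_at_mem(1)[OF p]])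
  also have "\<dots> = frobenius_pairing ?S (vertex x I) (vertex (basepoint_map (mirror D) p y) ?I')"
    by (rule frobenius_pairing_cong)
      (use fin p in \<open>simp_all add: vertex_basepoint_map circles_mirror[OF I] circle_at_mirror[OF I]\<close>)
  finally show "frobenius_pairing ?S (vertex (basepoint_map D p x) I) (vertex y ?I') =
    frobenius_pairing ?S (vertex x I) (vertex (basepoint_map (mirror D) p y) ?I')" .
qed

text \<open>
  The pairing of \<open>f\<^sub>p x\<close> and \<open>f\<^sub>p y\<close> in the reduced complexes is \<open>\<langle>x, f\<^sub>p y\<rangle> = \<langle>f\<^sub>p x, y\<rangle>\<close>. By
  self-adjointness it depends neither on the choice of \<open>x\<close> nor on that of \<open>y\<close>.
\<close>
lemma cube_pairing_section:
  assumes fin: "finite (arcs D)" and p: "p \<in> arcs D"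
  shows "cube_pairing \<eta> D (basepoint_section D p (basepoint_map D p x)) (basepoint_map (mirror D) p y) =
    cube_pairing \<eta> D (basepoint_map D p x) y"
  by (simp add: cube_pairing_basepoint_map[OF fin p, symmetric] basepoint_map_section[OF fin p])

text \<open>
  Both sides are sums over the edges \<open>I \<rightarrow> insert i I\<close> of the cube. In the mirror image the same edge is
  traversed backwards, by the adjoint saddle map, and the hypothesis on \<open>\<eta>\<close> says that the signs agree.
\<close>
lemma cube_pairing_dif:
  fixes x y :: "'e state \<Rightarrow> 'f::field UV"
  assumes fin: "finite (arcs D)"
    and \<eta>: "\<And>I i. I \<subseteq> {..<n_cross D} \<Longrightarrow> i < n_cross D \<Longrightarrow> i \<notin> I \<Longrightarrow>
      \<eta> (insert i I) * s I i = \<eta> I * s' ({..<n_cross D} - insert i I) i"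
  shows "cube_pairing \<eta> D (CKh_dif s D x) y = cube_pairing \<eta> D x (CKh_dif s' (mirror D) y)"
proof -
  let ?n = "{..<n_cross D}" and ?S = "circles D"
  define B where "B J i = frobenius_pairing (?S J)
    (saddle_map (?S (J - {i})) (?S J) (vertex x (J - {i}))) (vertex y (?n - J))" for J i
  define B' where "B' I i = frobenius_pairing (?S I) (vertex x I)
    (saddle_map (?S (insert i I)) (?S I) (vertex y (?n - insert i I)))" for I i
  have "cube_pairing \<eta> D (CKh_dif s D x) y =
      (\<Sum>J\<in>Pow ?n. \<Sum>i\<in>J. of_int (\<eta> J * s (J - {i}) i) * B J i)"
    unfolding cube_pairing_def
  proof (intro sum.cong refl)
    fix J assume "J \<in> Pow ?n"
    then have J: "J \<subseteq> ?n" by simp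
    have "frobenius_pairing (?S J) (vertex (CKh_dif s D x) J) (vertex y (?n - J)) =
      frobenius_pairing (?S J) (\<lambda>M. \<Sum>i\<in>J. of_int (s (J - {i}) i) *
        saddle_map (?S (J - {i})) (?S J) (vertex x (J - {i})) M) (vertex y (?n - J))"
      by (rule frobenius_pairing_cong) (simp_all add: vertex_CKh_dif[OF J])
    then show "of_int (\<eta> J) * frobenius_pairing (?S J) (vertex (CKh_dif s D x) J) (vertex y (?n - J)) =
        (\<Sum>i\<in>J. of_int (\<eta> J * s (J - {i}) i) * B J i)"
      by (simp add: frobenius_pairing_sum_left frobenius_pairing_scale_left sum_distrib_left B_def mult_ac)
  qed
  also have "\<dots> = (\<Sum>(J, i)\<in>Sigma (Pow ?n) (\<lambda>J. J). of_int (\<eta> J * s (J - {i}) i) * B J i)"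
    by (rule sum.Sigma) (auto intro: finite_subset)
  also have "\<dots> = (\<Sum>(I, i)\<in>Sigma (Pow ?n) (\<lambda>I. ?n - I). of_int (\<eta> I * s' (?n - insert i I) i) * B' I i)"
  proof (rule sum.reindex_bij_witness[of _ "\<lambda>(I, i). (insert i I, i)" "\<lambda>(J, i). (J - {i}, i)"])
    fix a assume "a \<in> Sigma (Pow ?n) (\<lambda>J. J)"
    then obtain J i where a: "a = (J, i)" "J \<subseteq> ?n" "i \<in> J" by auto
    define I where "I = J - {i}"
    have I: "J = insert i I" "i \<notin> I" "I \<subseteq> ?n" "i < n_cross D" using a by (auto simp: I_def)
    have "B J i = B' I i"
      using I(2) unfolding B_def B'_def I(1)
      by (simp add: saddle_map_adjoint[OF finite_circles[OF fin] finite_circles[OF fin]])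
    then show "(case case a of (J, i) \<Rightarrow> (J - {i}, i) of
          (I, i) \<Rightarrow> of_int (\<eta> I * s' (?n - insert i I) i) * B' I i) =
        (case a of (J, i) \<Rightarrow> of_int (\<eta> J * s (J - {i}) i) * B J i)"
      using \<eta>[OF I(3,4,2)] unfolding a(1) prod.case I_def[symmetric] unfolding I(1) by simp
  qed auto
  also have "\<dots> = (\<Sum>I\<in>Pow ?n. \<Sum>i\<in>?n - I. of_int (\<eta> I * s' (?n - insert i I) i) * B' I i)"
    by (rule sum.Sigma[symmetric]) auto
  also have "\<dots> = cube_pairing \<eta> D x (CKh_dif s' (mirror D) y)"
    unfolding cube_pairing_def
  proof (intro sum.cong refl)
    fix I assume "I \<in> Pow ?n"
    then have I: "I \<subseteq> ?n" by simp
    have c: "circles (mirror D) (?n - insert i I) = ?S (insert i I)" "?n - I - {i} = ?n - insert i I"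
      if "i \<in> ?n - I" for i
      using that I by (auto intro!: circles_mirror)
    have "frobenius_pairing (?S I) (vertex x I) (vertex (CKh_dif s' (mirror D) y) (?n - I)) =
      frobenius_pairing (?S I) (vertex x I) (\<lambda>M. \<Sum>i\<in>?n - I. of_int (s' (?n - insert i I) i) *
        saddle_map (?S (insert i I)) (?S I) (vertex y (?n - insert i I)) M)"
    proof (rule frobenius_pairing_cong[OF refl])
      fix M assume M: "M \<subseteq> ?S I"
      have "vertex (CKh_dif s' (mirror D) y) (?n - I) M =
        (\<Sum>i\<in>?n - I. of_int (s' (?n - I - {i}) i) * saddle_map (circles (mirror D) (?n - I - {i}))
          (circles (mirror D) (?n - I)) (vertex y (?n - I - {i})) M)"
        using M by (intro vertex_CKh_dif) (auto simp: circles_mirror[OF I])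
      also have "\<dots> = (\<Sum>i\<in>?n - I. of_int (s' (?n - insert i I) i) *
          saddle_map (?S (insert i I)) (?S I) (vertex y (?n - insert i I)) M)"
        by (intro sum.cong refl) (simp only: c circles_mirror[OF I])
      finally show "vertex (CKh_dif s' (mirror D) y) (?n - I) M =
        (\<Sum>i\<in>?n - I. of_int (s' (?n - insert i I) i) *
          saddle_map (?S (insert i I)) (?S I) (vertex y (?n - insert i I)) M)" .
    qed
    then show "(\<Sum>i\<in>?n - I. of_int (\<eta> I * s' (?n - insert i I) i) * B' I i) =
        of_int (\<eta> I) * frobenius_pairing (?S I) (vertex x I) (vertex (CKh_dif s' (mirror D) y) (?n - I))"
      by (simp add: frobenius_pairing_sum_right frobenius_pairing_scale_right sum_distrib_left B'_def mult_ac)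
  qed
  finally show ?thesis .
qed

section \<open>The pairing is perfect and graded\<close>

text \<open>
  The element of the complex of the mirror image that pairs with \<open>x\<close> to the coefficient of \<open>x\<close> at \<open>(I, K)\<close>,
  up to the sign \<open>\<eta> I\<close>.
\<close>
definition dual_state :: "'e diagram \<Rightarrow> nat set \<Rightarrow> 'e set set \<Rightarrow> 'e state \<Rightarrow> 'f::field UV" where
  "dual_state D I K = (\<lambda>(J, M).
     if J = {..<n_cross D} - I \<and> M \<subseteq> circles D I then dual_basis (circles D I) K M else 0)"

lemma complement_eq_iff:
  "I \<subseteq> N \<Longrightarrow> J \<subseteq> N \<Longrightarrow> N - I = N - J \<longleftrightarrow> I = J"
  by blast

lemma cube_pairing_dual_state:
  fixes x :: "'e state \<Rightarrow> 'f::field UV"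
  assumes fin: "finite (arcs D)" and I: "I \<subseteq> {..<n_cross D}" and K: "K \<subseteq> circles D I"
  shows "cube_pairing \<eta> D x (dual_state D I K) = of_int (\<eta> I) * x (I, K)"
proof -
  let ?n = "{..<n_cross D}"
  have "frobenius_pairing (circles D J) (vertex x J) (vertex (dual_state D I K) (?n - J)) =
      (if J = I then x (I, K) else 0)" if "J \<in> Pow ?n" for J
  proof (cases "J = I")
    case True
    have "frobenius_pairing (circles D I) (vertex x I) (vertex (dual_state D I K) (?n - I)) =
        frobenius_pairing (circles D I) (vertex x I) (dual_basis (circles D I) K)"
      by (rule frobenius_pairing_cong) (simp_all add: vertex_def dual_state_def)
    then show ?thesis
      using True frobenius_pairing_dual_basis[OF finite_circles[OF fin] K, of "vertex x I"]
      by (simp add: vertex_def)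
  next
    case False
    then have "vertex (dual_state D I K) (?n - J) = (\<lambda>M. 0 :: 'f UV)"
      using complement_eq_iff[of J ?n I] that I by (auto simp: vertex_def dual_state_def fun_eq_iff)
    then show ?thesis using False by (simp add: frobenius_pairing_zero_right)
  qed
  then have "cube_pairing \<eta> D x (dual_state D I K) =
      (\<Sum>J\<in>Pow ?n. if J = I then of_int (\<eta> I) * x (I, K) else 0)"
    unfolding cube_pairing_def by (intro sum.cong refl) simp
  then show ?thesis using I by simp
qed

lemma card_complement:
  "I \<subseteq> {..<n_cross D} \<Longrightarrow> int (card ({..<n_cross D} - I)) = int (n_pos D) + int (n_neg D) - int (card I)"
  using n_pos_plus_n_neg[of D] card_mono[of "{..<n_cross D}" I]
  by (simp add: card_Diff_subset finite_subset of_nat_diff)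

lemma dual_state_in_chain:
  assumes "I \<subseteq> {..<n_cross D}" "int (card I) = i + int (n_neg D)"
  shows "dual_state D I K \<in> CKh_chain (mirror D) (- i)"
  using assms card_complement[OF assms(1)]
  unfolding CKh_chain_iff by (auto simp: dual_state_def circles_mirror split: if_splits)

lemma linear_to_ring_add:
  assumes "linear_to_ring N h" "x \<in> N" "y \<in> N"
  shows "h (\<lambda>k. x k + y k) = h x + h y"
  using assms(1)[unfolded linear_to_ring_def, THEN conjunct1, rule_format, OF assms(2,3)] .

lemma linear_to_ring_scale:
  assumes "linear_to_ring N h" "x \<in> N"
  shows "h (\<lambda>k. r * x k) = r * h x"
  using assms(1)[unfolded linear_to_ring_def, THEN conjunct2, rule_format, OF assms(2)] .

lemma linear_to_ring_sum:
  assumes h: "linear_to_ring (CKh_chain D i) h" and "finite A" "\<And>k. k \<in> A \<Longrightarrow> e k \<in> CKh_chain D i"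
  shows "h (\<lambda>l. \<Sum>k\<in>A. r k * e k l) = (\<Sum>k\<in>A. r k * h (e k)) \<and>
    (\<lambda>l. \<Sum>k\<in>A. r k * e k l) \<in> CKh_chain D i"
  using assms(2,3)
proof (induction A rule: finite_induct)
  case empty
  show ?case using linear_to_ring_scale[OF h CKh_chain_zero, of 0] CKh_chain_zero[of D i] by simp
next
  case (insert a A)
  have a: "(\<lambda>l. r a * e a l) \<in> CKh_chain D i" using insert.prems by (intro CKh_chain_scale) auto
  have "h (\<lambda>l. r a * e a l) = r a * h (e a)"
    using insert.prems by (intro linear_to_ring_scale[OF h]) simp
  moreover have "h (\<lambda>l. r a * e a l + (\<Sum>k\<in>A. r k * e k l)) =
      h (\<lambda>l. r a * e a l) + h (\<lambda>l. \<Sum>k\<in>A. r k * e k l)"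
    using a insert by (intro linear_to_ring_add[OF h]) auto
  ultimately show ?case using insert CKh_chain_add[OF a] by simp
qed

lemma finite_states: "finite (arcs D) \<Longrightarrow> finite (states D)"
proof -
  assume fin: "finite (arcs D)"
  have "states D = Sigma (Pow {..<n_cross D}) (\<lambda>I. Pow (circles D I))" by (auto simp: states_def)
  then show ?thesis using finite_circles[OF fin] by simp
qed

text \<open>
  Every functional is a combination of coefficient functionals, and pairing with the dual basis
  elements yields exactly these.
\<close>
lemma cube_pairing_perfect:
  fixes h :: "('e state \<Rightarrow> 'f::field UV) \<Rightarrow> 'f UV"
  assumes fin: "finite (arcs D)" and h: "linear_to_ring (CKh_chain (mirror D) (- i)) h"
    and \<eta>: "\<And>I. I \<subseteq> {..<n_cross D} \<Longrightarrow> \<eta> I * \<eta> I = 1"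
  shows "\<exists>x\<in>CKh_chain D i. \<forall>y\<in>CKh_chain (mirror D) (- i). cube_pairing \<eta> D x y = h y"
proof -
  let ?n = "{..<n_cross D}"
  define e :: "'e state \<Rightarrow> 'e state \<Rightarrow> 'f UV" where "e k l = (if l = k then 1 else 0)" for k l
  define x where "x = (\<lambda>(I, K). if I \<subseteq> ?n \<and> K \<subseteq> circles D I \<and> int (card I) = i + int (n_neg D)
    then of_int (\<eta> I) * (\<Sum>M\<in>Pow (circles D I). h (e (?n - I, M)) * dual_basis (circles D I) M K)
    else 0)"
  have x: "x \<in> CKh_chain D i" unfolding CKh_chain_iff by (auto simp: x_def split: if_splits)
  show ?thesis
  proof (intro bexI[OF _ x] ballI)
    fix y :: "'e state \<Rightarrow> 'f UV" assume y: "y \<in> CKh_chain (mirror D) (- i)"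
    define A where "A = {k \<in> states (mirror D). hgr (mirror D) k = - i}"
    have "cube_pairing \<eta> D x y =
        (\<Sum>I\<in>Pow ?n. \<Sum>M\<in>Pow (circles D I). y (?n - I, M) * h (e (?n - I, M)))"
      unfolding cube_pairing_def
    proof (intro sum.cong refl)
      fix I assume "I \<in> Pow ?n"
      then have I: "I \<subseteq> ?n" by simp
      let ?S = "circles D I"
      show "of_int (\<eta> I) * frobenius_pairing ?S (vertex x I) (vertex y (?n - I)) =
          (\<Sum>M\<in>Pow ?S. y (?n - I, M) * h (e (?n - I, M)))"
      proof (cases "int (card I) = i + int (n_neg D)")
        case True
        have dual: "frobenius_pairing ?S (dual_basis ?S M) (vertex y (?n - I)) = y (?n - I, M)"
          if "M \<subseteq> ?S" for M
          using frobenius_pairing_dual_basis[OF finite_circles[OF fin] that, of "vertex y (?n - I)"]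
          by (simp add: frobenius_pairing_commute vertex_def)
        have "frobenius_pairing ?S (vertex x I) (vertex y (?n - I)) = frobenius_pairing ?S
            (\<lambda>K. of_int (\<eta> I) * (\<Sum>M\<in>Pow ?S. h (e (?n - I, M)) * dual_basis ?S M K)) (vertex y (?n - I))"
          by (rule frobenius_pairing_cong) (simp_all add: vertex_def x_def I True)
        also have "\<dots> = of_int (\<eta> I) * (\<Sum>M\<in>Pow ?S. h (e (?n - I, M)) *
            frobenius_pairing ?S (dual_basis ?S M) (vertex y (?n - I)))"
          by (simp only: frobenius_pairing_sum_left frobenius_pairing_scale_left)
        also have "\<dots> = of_int (\<eta> I) * (\<Sum>M\<in>Pow ?S. y (?n - I, M) * h (e (?n - I, M)))"
          using dual by (simp add: mult.commute)
        finally have "of_int (\<eta> I) * frobenius_pairing ?S (vertex x I) (vertex y (?n - I)) =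
            of_int (\<eta> I * \<eta> I) * (\<Sum>M\<in>Pow ?S. y (?n - I, M) * h (e (?n - I, M)))"
          by simp
        then show ?thesis using \<eta>[OF I] by simp
      next
        case False
        then have "int (card (?n - I)) \<noteq> - i + int (n_neg (mirror D))"
          using card_complement[OF I] by simp
        then have "y (?n - I, M) = 0" for M using y unfolding CKh_chain_iff by blast
        moreover have "vertex x I = (\<lambda>L. 0)" using False by (auto simp: vertex_def x_def)
        ultimately show ?thesis by (simp add: frobenius_pairing_zero_left)
      qed
    qed
    also have "\<dots> = (\<Sum>(I, M)\<in>Sigma (Pow ?n) (\<lambda>I. Pow (circles D I)). y (?n - I, M) * h (e (?n - I, M)))"
      using finite_circles[OF fin] by (intro sum.Sigma) auto
    also have "\<dots> = (\<Sum>k\<in>states (mirror D). y k * h (e k))"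
      by (rule sum.reindex_bij_witness[of _ "\<lambda>(J, M). (?n - J, M)" "\<lambda>(I, M). (?n - I, M)"])
        (auto simp: states_iff circles_mirror circles_mirror' double_diff, blast)
    also have "\<dots> = (\<Sum>k\<in>A. y k * h (e k))"
      using y finite_states[of "mirror D"] fin
      by (intro sum.mono_neutral_right) (auto simp: A_def CKh_chain_def)
    also have "\<dots> = h (\<lambda>l. \<Sum>k\<in>A. y k * e k l)"
      by (rule linear_to_ring_sum[OF h, THEN conjunct1, symmetric])
        (use finite_states[of "mirror D"] fin in \<open>auto simp: A_def e_def CKh_chain_def\<close>)
    also have "(\<lambda>l. \<Sum>k\<in>A. y k * e k l) = y"
    proof (rule ext)
      fix l
      have "(\<Sum>k\<in>A. y k * e k l) = (\<Sum>k\<in>A. if k = l then y l else 0)"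
        by (intro sum.cong refl) (auto simp: e_def)
      also have "\<dots> = y l"
      proof (cases "y l = 0")
        case False
        then have "l \<in> A" using y unfolding A_def CKh_chain_def by blast
        moreover have "finite A" using finite_states[of "mirror D"] fin by (simp add: A_def)
        ultimately show ?thesis by simp
      qed (auto intro: sum.neutral)
      finally show "(\<Sum>k\<in>A. y k * e k l) = y l" .
    qed
    finally show "cube_pairing \<eta> D x y = h y" .
  qed
qed

text \<open>
  The part of the quantum grading that depends only on the vertex of the cube. It changes sign when \<open>D\<close>
  is replaced by its mirror image and \<open>I\<close> by its complement, which is why the pairing is graded.
\<close>
definition vertex_shift :: "'e diagram \<Rightarrow> nat set \<Rightarrow> int" where
  "vertex_shift D I = int (card I) + int (n_pos D) - 2 * int (n_neg D)"

lemma qgr_eq: "qgr D (I, L) = tensor_degree (circles D I) L + vertex_shift D I"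
  by (simp add: qgr_def tensor_degree_def vertex_shift_def)

lemma vertex_shift_mirror:
  "I \<subseteq> {..<n_cross D} \<Longrightarrow> vertex_shift (mirror D) ({..<n_cross D} - I) = - vertex_shift D I"
  using card_complement[of I D] by (simp add: vertex_shift_def)

definition CKh_homogeneous :: "'e diagram \<Rightarrow> int \<Rightarrow> ('e state \<Rightarrow> 'f::field UV) \<Rightarrow> bool" where
  "CKh_homogeneous D q x \<longleftrightarrow> (\<forall>k\<in>states D. x k \<in> homog_UV (q - qgr D k))"

lemma CKh_homogeneous_iff:
  "CKh_homogeneous D q x \<longleftrightarrow>
    (\<forall>I\<subseteq>{..<n_cross D}. homogeneous (circles D I) (q - vertex_shift D I) (vertex x I))"
  by (auto simp: CKh_homogeneous_def homogeneous_def states_def qgr_eq vertex_def algebra_simps)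

lemma cube_pairing_homogeneous:
  assumes fin: "finite (arcs D)"
    and x: "CKh_homogeneous D q x" and y: "CKh_homogeneous (mirror D) r y"
  shows "cube_pairing \<eta> D x y \<in> homog_UV (q + r)"
  unfolding cube_pairing_def
proof (intro homog_UV_sum homog_UV_of_int_mult)
  fix I assume "I \<in> Pow {..<n_cross D}"
  then have I: "I \<subseteq> {..<n_cross D}" by simp
  have "homogeneous (circles D I) (q - vertex_shift D I) (vertex x I)"
    using x I by (simp add: CKh_homogeneous_iff)
  moreover have "homogeneous (circles D I) (r + vertex_shift D I) (vertex y ({..<n_cross D} - I))"
    using y[unfolded CKh_homogeneous_iff, rule_format, of "{..<n_cross D} - I"]
    by (simp add: circles_mirror[OF I] vertex_shift_mirror[OF I])
  ultimately have "frobenius_pairing (circles D I) (vertex x I) (vertex y ({..<n_cross D} - I))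
      \<in> homog_UV (q - vertex_shift D I + (r + vertex_shift D I))"
    by (rule frobenius_pairing_homogeneous[OF finite_circles[OF fin]])
  then show "frobenius_pairing (circles D I) (vertex x I) (vertex y ({..<n_cross D} - I))
      \<in> homog_UV (q + r)" by simp
qed

lemma homogeneous_cong:
  "(\<And>L. L \<subseteq> S \<Longrightarrow> x L = y L) \<Longrightarrow> homogeneous S d x \<longleftrightarrow> homogeneous S d y"
  by (simp add: homogeneous_def)

lemma dual_state_homogeneous:
  assumes fin: "finite (arcs D)" and I: "I \<subseteq> {..<n_cross D}" and K: "K \<subseteq> circles D I"
  shows "CKh_homogeneous (mirror D) (- qgr D (I, K)) (dual_state D I K)"
  unfolding CKh_homogeneous_def
proof
  fix k assume k: "k \<in> states (mirror D)"
  obtain J M where JM: "k = (J, M)" by (cases k)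
  show "dual_state D I K k \<in> homog_UV (- qgr D (I, K) - qgr (mirror D) k)"
  proof (cases "J = {..<n_cross D} - I \<and> M \<subseteq> circles D I")
    case True
    have "dual_basis (circles D I) K M
        \<in> homog_UV (- tensor_degree (circles D I) K - tensor_degree (circles D I) M)"
      using dual_basis_homogeneous[OF finite_circles[OF fin] K] True unfolding homogeneous_def by blast
    then show ?thesis
      using True by (simp add: JM dual_state_def qgr_eq circles_mirror[OF I] vertex_shift_mirror[OF I])
  next
    case False
    then show ?thesis by (auto simp: JM dual_state_def homog_UV_0)
  qed
qed

lemma basepoint_map_homogeneous:
  assumes fin: "finite (arcs D)" and p: "p \<in> arcs D" and x: "CKh_homogeneous D q x"
  shows "CKh_homogeneous D (q - 2) (basepoint_map D p x)"
  unfolding CKh_homogeneous_iff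
proof (intro allI impI)
  fix I assume I: "I \<subseteq> {..<n_cross D}"
  have "homogeneous (circles D I) (q - vertex_shift D I - 2)
      (mult_X_minus_U (circle_at D I p) (vertex x I))"
    using x I
    by (intro mult_X_minus_U_homogeneous finite_circles[OF fin] circle_at_mem(1)[OF p])
      (simp add: CKh_homogeneous_iff)
  also have "q - vertex_shift D I - 2 = q - 2 - vertex_shift D I" by simp
  finally show "homogeneous (circles D I) (q - 2 - vertex_shift D I) (vertex (basepoint_map D p x) I)"
    by (simp add: homogeneous_cong[OF vertex_basepoint_map[OF fin p I]])
qed

lemma basepoint_section_homogeneous:
  assumes fin: "finite (arcs D)" and p: "p \<in> arcs D" and x: "CKh_homogeneous D q x"
  shows "CKh_homogeneous D (q + 2) (basepoint_section D p x)"
  unfolding CKh_homogeneous_iff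
proof (intro allI impI)
  fix I assume I: "I \<subseteq> {..<n_cross D}"
  have "homogeneous (circles D I) (q - vertex_shift D I + 2)
      (div_X_minus_U (circle_at D I p) (vertex x I))"
    using x I
    by (intro div_X_minus_U_homogeneous finite_circles[OF fin] circle_at_mem(1)[OF p])
      (simp add: CKh_homogeneous_iff)
  also have "q - vertex_shift D I + 2 = q + 2 - vertex_shift D I" by simp
  finally show "homogeneous (circles D I) (q + 2 - vertex_shift D I) (vertex (basepoint_section D p x) I)"
    by (simp add: homogeneous_cong[OF vertex_basepoint_section[OF I]])
qed

section \<open>The duality isomorphism\<close>

abbreviation reduced_chain :: "'e diagram \<Rightarrow> 'e \<Rightarrow> int \<Rightarrow> ('e state \<Rightarrow> 'f::field UV) set" where
  "reduced_chain D p i \<equiv> basepoint_map D p ` CKh_chain D i"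

lemma reduced_chain_subset: "reduced_chain D p i \<subseteq> CKh_chain D i"
  by (rule image_subsetI) (rule basepoint_map_in_chain)

lemma reduced_chain_outside:
  assumes "z \<in> reduced_chain D p i"
    and "\<not> (I \<subseteq> {..<n_cross D} \<and> L \<subseteq> circles D I \<and> int (card I) = i + int (n_neg D))"
  shows "z (I, L) = 0"
  using subsetD[OF reduced_chain_subset assms(1), unfolded CKh_chain_iff, rule_format, of I L] assms(2)
  by blast

lemma basepoint_map_section_reduced:
  assumes "finite (arcs D)" "p \<in> arcs D" "z \<in> reduced_chain D p i"
  shows "basepoint_map D p (basepoint_section D p z) = z"
  using assms(3) by (rule imageE) (simp only: basepoint_map_section[OF assms(1,2)])

lemma reduced_chain_dif:
  assumes "finite (arcs D)" "p \<in> arcs D" "z \<in> reduced_chain D p i"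
  shows "CKh_dif s D z \<in> reduced_chain D p (i + 1)"
  using assms(3)
proof (rule imageE)
  fix x assume "z = basepoint_map D p x" "x \<in> CKh_chain D i"
  then show ?thesis
    by (simp only: basepoint_map_commutes[OF assms(1,2), symmetric] imageI CKh_dif_in_chain)
qed

lemma reduced_chain_add:
  "x \<in> reduced_chain D p i \<Longrightarrow> y \<in> reduced_chain D p i \<Longrightarrow> (\<lambda>k. x k + y k) \<in> reduced_chain D p i"
  by (elim imageE) (simp only: basepoint_map_add[symmetric] imageI CKh_chain_add)

lemma reduced_chain_scale:
  "x \<in> reduced_chain D p i \<Longrightarrow> (\<lambda>k. r * x k) \<in> reduced_chain D p i"
  by (elim imageE) (simp only: basepoint_map_scale[symmetric] imageI CKh_chain_scale)

text \<open>
  The functional \<open>f\<^sub>p y \<mapsto> \<langle>x, f\<^sub>p y\<rangle>\<close> attached to \<open>z = f\<^sub>p x\<close>. Outside the reduced complex it is zero by the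
  convention for representing functionals.
\<close>
definition duality_map ::
    "(nat set \<Rightarrow> int) \<Rightarrow> 'e diagram \<Rightarrow> 'e \<Rightarrow> int \<Rightarrow> ('e state \<Rightarrow> 'f::field UV) \<Rightarrow>
      ('e state \<Rightarrow> 'f UV) \<Rightarrow> 'f UV" where
  "duality_map \<eta> D p i z = (\<lambda>w. if w \<in> reduced_chain (mirror D) p (- i)
     then cube_pairing \<eta> D (basepoint_section D p z) w else 0)"

lemma duality_map_basepoint_map:
  assumes fin: "finite (arcs D)" and p: "p \<in> arcs D"
    and z: "z \<in> reduced_chain D p i" and y: "y \<in> CKh_chain (mirror D) (- i)"
  shows "duality_map \<eta> D p i z (basepoint_map (mirror D) p y) = cube_pairing \<eta> D z y"
proof -
  obtain x where x: "z = basepoint_map D p x" using z by (rule imageE)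
  have "basepoint_map (mirror D) p y \<in> reduced_chain (mirror D) p (- i)" using y by (rule imageI)
  then show ?thesis unfolding duality_map_def x by (simp add: cube_pairing_section[OF fin p])
qed

lemma duality_map_dual_state:
  fixes z :: "'e state \<Rightarrow> 'f::field UV"
  assumes fin: "finite (arcs D)" and p: "p \<in> arcs D" and z: "z \<in> reduced_chain D p i"
    and I: "I \<subseteq> {..<n_cross D}" "int (card I) = i + int (n_neg D)" and K: "K \<subseteq> circles D I"
  shows "duality_map \<eta> D p i z (basepoint_map (mirror D) p (dual_state D I K)) = of_int (\<eta> I) * z (I, K)"
  using duality_map_basepoint_map[OF fin p z dual_state_in_chain[OF I]]
  by (simp add: cube_pairing_dual_state[OF fin I(1) K])

lemma chain_reduced_CKh [simp]: "chain (reduced_CKh s D p) i = reduced_chain D p i"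
  by (simp add: reduced_CKh_def CKh_def)

lemma homog_reduced_CKh [simp]:
  "homog (reduced_CKh s D p) i q = {z \<in> reduced_chain D p i. CKh_homogeneous D (q - 1) z}"
proof -
  have "basepoint_map D p ` CKh_chain D i \<inter> {x \<in> CKh_chain D i. CKh_homogeneous D (q - 1) x} =
      {z \<in> reduced_chain D p i. CKh_homogeneous D (q - 1) z}"
    using reduced_chain_subset[of D p i] by blast
  then show ?thesis by (simp add: reduced_CKh_def CKh_def CKh_homogeneous_def)
qed

lemma dif_reduced_CKh [simp]: "dif (reduced_CKh s D p) i = CKh_dif s D"
  by (simp add: reduced_CKh_def CKh_def)

lemma duality_map_in_dual_chain:
  "duality_map \<eta> D p i z \<in> dual_chain (reduced_CKh s' (mirror D) p) i"
proof -
  have "linear_to_ring (reduced_chain (mirror D) p (- i)) (duality_map \<eta> D p i z)"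
    unfolding linear_to_ring_def
    by (intro conjI ballI allI)
      (simp_all only: duality_map_def reduced_chain_add reduced_chain_scale cube_pairing_linear if_True)
  moreover have "duality_map \<eta> D p i z w = 0" if "w \<notin> reduced_chain (mirror D) p (- i)" for w
    using that by (simp only: duality_map_def if_False)
  ultimately show ?thesis unfolding dual_chain_def chain_reduced_CKh by blast
qed

text \<open>
  Testing against the images of the dual basis elements recovers all coefficients of \<open>z\<close>, which gives
  injectivity. For surjectivity, a functional on the reduced complex of the mirror image is extended to
  the whole complex by the projection \<open>\<pi>\<close>, represented there as \<open>\<langle>x, -\<rangle>\<close>, and then it is the image of
  \<open>f\<^sub>p x\<close>, because \<open>\<langle>f\<^sub>p x, y\<rangle> = \<langle>x, f\<^sub>p y\<rangle>\<close>.
\<close>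
lemma duality_map_bij:
  fixes D :: "'e diagram"
  assumes fin: "finite (arcs D)" and p: "p \<in> arcs D"
    and \<eta>: "\<And>I. I \<subseteq> {..<n_cross D} \<Longrightarrow> \<eta> I * \<eta> I = 1"
  shows "bij_betw (duality_map \<eta> D p i :: ('e state \<Rightarrow> 'f::field UV) \<Rightarrow> _)
    (reduced_chain D p i) (dual_chain (reduced_CKh s' (mirror D) p) i)"
proof (rule bij_betw_imageI)
  show "inj_on (duality_map \<eta> D p i :: ('e state \<Rightarrow> 'f UV) \<Rightarrow> _) (reduced_chain D p i)"
  proof (rule inj_onI)
    fix z z' :: "'e state \<Rightarrow> 'f UV"
    assume z: "z \<in> reduced_chain D p i" "z' \<in> reduced_chain D p i"
      and eq: "duality_map \<eta> D p i z = duality_map \<eta> D p i z'"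
    show "z = z'"
    proof (rule ext)
      fix k :: "'e state"
      obtain I K where k: "k = (I, K)" by (cases k)
      show "z k = z' k"
      proof (cases "I \<subseteq> {..<n_cross D} \<and> K \<subseteq> circles D I \<and> int (card I) = i + int (n_neg D)")
        case True
        then have IK: "I \<subseteq> {..<n_cross D}" "int (card I) = i + int (n_neg D)" "K \<subseteq> circles D I"
          by auto
        have "of_int (\<eta> I) * z k = of_int (\<eta> I) * z' k"
          using duality_map_dual_state[OF fin p z(1) IK, of \<eta>]
            duality_map_dual_state[OF fin p z(2) IK, of \<eta>] unfolding eq k by (rule trans[OF sym])
        then have "of_int (\<eta> I * \<eta> I) * z k = of_int (\<eta> I * \<eta> I) * z' k"
          by (simp add: mult.assoc)
        then show ?thesis using \<eta>[OF IK(1)] by simp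
      next
        case False
        have "z k = 0" "z' k = 0"
          unfolding k using reduced_chain_outside[OF z(1) False] reduced_chain_outside[OF z(2) False] .
        then show ?thesis by simp
      qed
    qed
  qed
next
  show "duality_map \<eta> D p i ` reduced_chain D p i =
    (dual_chain (reduced_CKh s' (mirror D) p) i :: (('e state \<Rightarrow> 'f UV) \<Rightarrow> 'f UV) set)"
  proof (intro equalityI image_subsetI subsetI)
    fix f :: "('e state \<Rightarrow> 'f UV) \<Rightarrow> 'f UV"
    assume f: "f \<in> dual_chain (reduced_CKh s' (mirror D) p) i"
    let ?\<pi> = "\<lambda>y. basepoint_map (mirror D) p (basepoint_section (mirror D) p y)"
    have lin: "linear_to_ring (reduced_chain (mirror D) p (- i)) f"
      and out: "\<And>w. w \<notin> reduced_chain (mirror D) p (- i) \<Longrightarrow> f w = 0"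
      using f by (auto simp: dual_chain_def)
    have \<pi>: "?\<pi> y \<in> reduced_chain (mirror D) p (- i)" if "y \<in> CKh_chain (mirror D) (- i)"
      for y :: "'e state \<Rightarrow> 'f UV"
      using that by (intro imageI basepoint_section_in_chain)
    have f\<pi>: "linear_to_ring (CKh_chain (mirror D) (- i)) (\<lambda>y. f (?\<pi> y))"
      unfolding linear_to_ring_def
      by (intro conjI ballI allI)
        (simp_all only: basepoint_map_add basepoint_map_scale basepoint_section_add
          basepoint_section_scale linear_to_ring_add[OF lin] linear_to_ring_scale[OF lin] \<pi>)
    obtain x where x: "x \<in> CKh_chain D i"
      "\<forall>y\<in>CKh_chain (mirror D) (- i). cube_pairing \<eta> D x y = f (?\<pi> y)"
      using cube_pairing_perfect[OF fin f\<pi> \<eta>] by (rule bexE)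
    have "duality_map \<eta> D p i (basepoint_map D p x) = f"
    proof (rule ext)
      fix w :: "'e state \<Rightarrow> 'f UV"
      show "duality_map \<eta> D p i (basepoint_map D p x) w = f w"
      proof (cases "w \<in> reduced_chain (mirror D) p (- i)")
        case True
        then obtain y where y: "y \<in> CKh_chain (mirror D) (- i)" "w = basepoint_map (mirror D) p y"
          by blast
        have "duality_map \<eta> D p i (basepoint_map D p x) w = cube_pairing \<eta> D x w"
          using duality_map_basepoint_map[OF fin p imageI[OF x(1)] y(1)] y(2)
          by (simp add: cube_pairing_basepoint_map[OF fin p])
        also have "\<dots> = f (?\<pi> w)"
          by (rule x(2)[rule_format, OF subsetD[OF reduced_chain_subset True]])
        also have "?\<pi> w = w"
          using True fin p by (intro basepoint_map_section_reduced) auto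
        finally show ?thesis .
      qed (simp add: duality_map_def out)
    qed
    then show "f \<in> duality_map \<eta> D p i ` reduced_chain D p i" using x(1) by blast
  qed (rule duality_map_in_dual_chain)
qed

text \<open>
  The basepoint map has degree \<open>-2\<close> and the reduced complex is shifted by \<open>1\<close>. If \<open>f\<^sub>p x\<close> and \<open>f\<^sub>p y\<close> have
  reduced gradings \<open>q\<close> and \<open>j\<close>, then \<open>x\<close> has grading \<open>q + 1\<close> and \<open>f\<^sub>p y\<close> has grading \<open>j - 1\<close> in the unreduced
  complexes, and \<open>\<langle>x, f\<^sub>p y\<rangle>\<close> has degree \<open>j + q\<close>. Conversely, the coefficients of \<open>f\<^sub>p x\<close> are values of the functional
  at homogeneous elements.
\<close>
lemma duality_map_homogeneous:
  fixes z :: "'e state \<Rightarrow> 'f::field UV"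
  assumes fin: "finite (arcs D)" and p: "p \<in> arcs D"
    and \<eta>: "\<And>I. I \<subseteq> {..<n_cross D} \<Longrightarrow> \<eta> I * \<eta> I = 1" and z: "z \<in> reduced_chain D p i"
  shows "CKh_homogeneous D (q - 1) z \<longleftrightarrow>
    (\<forall>j. \<forall>w\<in>homog (reduced_CKh s' (mirror D) p) (- i) j. duality_map \<eta> D p i z w \<in> homog_UV (j + q))"
    (is "?L \<longleftrightarrow> ?R")
proof
  assume ?L
  then have "CKh_homogeneous D (q + 1) (basepoint_section D p z)"
    using basepoint_section_homogeneous[OF fin p, of "q - 1" z] by (simp add: add.commute)
  then have "cube_pairing \<eta> D (basepoint_section D p z) w \<in> homog_UV (j + q)"
    if "CKh_homogeneous (mirror D) (j - 1) w" for j w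
    using cube_pairing_homogeneous[OF fin _ that, of "q + 1"] by (simp add: add.commute)
  then show ?R by (simp add: duality_map_def)
next
  assume R: ?R
  show ?L
    unfolding CKh_homogeneous_def
  proof
    fix k assume "k \<in> states D"
    then obtain I K where k: "k = (I, K)" "I \<subseteq> {..<n_cross D}" "K \<subseteq> circles D I"
      by (cases k) (simp add: states_iff)
    show "z k \<in> homog_UV (q - 1 - qgr D k)"
    proof (cases "int (card I) = i + int (n_neg D)")
      case True
      let ?y = "dual_state D I K :: 'e state \<Rightarrow> 'f UV"
      let ?w = "basepoint_map (mirror D) p ?y"
      have "CKh_homogeneous (mirror D) (- qgr D k - 2) ?w"
        unfolding k(1) by (rule basepoint_map_homogeneous) (use fin p k dual_state_homogeneous in auto)
      moreover have "- qgr D k - 2 = (- 1 - qgr D k) - 1" by simp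
      moreover have "?y \<in> CKh_chain (mirror D) (- i)" by (rule dual_state_in_chain[OF k(2) True])
      ultimately have "?w \<in> homog (reduced_CKh s' (mirror D) p) (- i) (- 1 - qgr D k)"
        by (simp add: imageI)
      then have "duality_map \<eta> D p i z ?w \<in> homog_UV (- 1 - qgr D k + q)" using R by blast
      then have "of_int (\<eta> I) * z k \<in> homog_UV (- 1 - qgr D k + q)"
        using duality_map_dual_state[OF fin p z k(2) True k(3)] k(1) by simp
      then have "of_int (\<eta> I) * (of_int (\<eta> I) * z k) \<in> homog_UV (- 1 - qgr D k + q)"
        by (rule homog_UV_of_int_mult)
      also have "of_int (\<eta> I) * (of_int (\<eta> I) * z k) = of_int (\<eta> I * \<eta> I) * z k"
        by (simp add: mult.assoc)
      finally show ?thesis using \<eta>[OF k(2)] by (simp add: algebra_simps)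
    next
      case False
      then have "z k = 0" unfolding k by (intro reduced_chain_outside[OF z]) blast
      then show ?thesis by (simp add: homog_UV_0)
    qed
  qed
qed

text \<open>
  Writing \<open>w = f\<^sub>p y\<close>, both sides are the pairing of \<open>z\<close> with the differential of \<open>y\<close>, because the
  differential is self-adjoint for the pairing and commutes with the basepoint map.
\<close>
lemma duality_map_dif:
  fixes z :: "'e state \<Rightarrow> 'f::field UV"
  assumes fin: "finite (arcs D)" and p: "p \<in> arcs D"
    and \<eta>: "\<And>I i. I \<subseteq> {..<n_cross D} \<Longrightarrow> i < n_cross D \<Longrightarrow> i \<notin> I \<Longrightarrow>
      \<eta> (insert i I) * s I i = \<eta> I * s' ({..<n_cross D} - insert i I) i"
    and z: "z \<in> reduced_chain D p i"
  shows "duality_map \<eta> D p (i + 1) (CKh_dif s D z) =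
    dif (dual_complex (reduced_CKh s' (mirror D) p)) i (duality_map \<eta> D p i z)"
proof (rule ext)
  fix w :: "'e state \<Rightarrow> 'f UV"
  show "duality_map \<eta> D p (i + 1) (CKh_dif s D z) w =
    dif (dual_complex (reduced_CKh s' (mirror D) p)) i (duality_map \<eta> D p i z) w"
  proof (cases "w \<in> reduced_chain (mirror D) p (- (i + 1))")
    case True
    then obtain y where y: "y \<in> CKh_chain (mirror D) (- (i + 1))" "w = basepoint_map (mirror D) p y"
      by blast
    have dy: "CKh_dif s' (mirror D) y \<in> CKh_chain (mirror D) (- i)"
      using CKh_dif_in_chain[OF y(1)] by simp
    have "duality_map \<eta> D p (i + 1) (CKh_dif s D z) w = cube_pairing \<eta> D (CKh_dif s D z) y"
      unfolding y(2) by (rule duality_map_basepoint_map[OF fin p reduced_chain_dif[OF fin p z] y(1)])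
    also have "\<dots> = cube_pairing \<eta> D z (CKh_dif s' (mirror D) y)"
      by (rule cube_pairing_dif[OF fin \<eta>])
    also have "\<dots> = duality_map \<eta> D p i z (basepoint_map (mirror D) p (CKh_dif s' (mirror D) y))"
      by (rule duality_map_basepoint_map[OF fin p z dy, symmetric])
    also have "\<dots> = duality_map \<eta> D p i z (CKh_dif s' (mirror D) w)"
      unfolding y(2) using fin p by (simp add: basepoint_map_commutes)
    finally show ?thesis using True by (simp add: dual_complex_def)
  next
    case False
    then show ?thesis by (simp add: dual_complex_def duality_map_def)
  qed
qed

theorem proposition4p20:
  fixes D :: "'e diagram" and p :: 'e
    and s s' :: "nat set \<Rightarrow> nat \<Rightarrow> int"
  assumes "link_diagram D" and "p \<in> arcs D"
    and "sign_assignment (n_cross D) s"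
    and "sign_assignment (n_cross (mirror D)) s'"
  shows "isomorphic_complexes
           (reduced_CKh s D p :: ('e state, 'f::field UV) graded_complex)
           (dual_complex (reduced_CKh s' (mirror D) p))"
proof -
  have fin: "finite (arcs D)" using assms(1) by (simp add: link_diagram_def)
  note p = assms(2)
  have t: "sign_assignment (n_cross D) (\<lambda>I i. s' ({..<n_cross D} - insert i I) i)"
    using assms(4) by (intro sign_assignment_complement) simp
  obtain \<eta> where
    \<eta>: "\<And>I. I \<subseteq> {..<n_cross D} \<Longrightarrow> \<eta> I * \<eta> I = 1"
    and gauge: "\<And>I i. I \<subseteq> {..<n_cross D} \<Longrightarrow> i < n_cross D \<Longrightarrow> i \<notin> I \<Longrightarrow>
      \<eta> (insert i I) * s I i = \<eta> I * s' ({..<n_cross D} - insert i I) i"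
    using sign_assignments_cohomologous[OF assms(3) t] by blast
  let ?C = "reduced_CKh s D p :: ('e state, 'f UV) graded_complex"
  let ?C' = "reduced_CKh s' (mirror D) p :: ('e state, 'f UV) graded_complex"
  let ?\<phi> = "duality_map \<eta> D p :: int \<Rightarrow> ('e state \<Rightarrow> 'f UV) \<Rightarrow> _"
  show ?thesis
    unfolding isomorphic_complexes_def
  proof (intro exI[of _ ?\<phi>] allI conjI ballI)
    fix i
    show bij: "bij_betw (?\<phi> i) (chain ?C i) (chain (dual_complex ?C') i)"
      using duality_map_bij[OF fin p \<eta>] by (simp add: dual_complex_def)
    show "linear_between (chain ?C i) (?\<phi> i)"
      by (auto simp: linear_between_def duality_map_def basepoint_section_add basepoint_section_scale
          cube_pairing_linear fun_eq_iff)
    show "?\<phi> i ` homog ?C i q = homog (dual_complex ?C') i q" for q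
    proof -
      have iff: "CKh_homogeneous D (q - 1) z \<longleftrightarrow>
          (\<forall>j. \<forall>w\<in>homog ?C' (- i) j. ?\<phi> i z w \<in> homog_UV (j + q))"
        if "z \<in> reduced_chain D p i" for z
        by (rule duality_map_homogeneous[OF fin p \<eta> that])
      have "homog (dual_complex ?C') i q = {f \<in> ?\<phi> i ` reduced_chain D p i.
          \<forall>j. \<forall>w\<in>homog ?C' (- i) j. f w \<in> homog_UV (j + q)}"
        using bij_betw_imp_surj_on[OF bij] by (simp add: dual_complex_def)
      also have "\<dots> = ?\<phi> i ` {z \<in> reduced_chain D p i. CKh_homogeneous D (q - 1) z}"
        using iff by blast
      finally show ?thesis by simp
    qed
    show "?\<phi> (i + 1) (dif ?C i z) = dif (dual_complex ?C') i (?\<phi> i z)" if "z \<in> chain ?C i" for z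
      using that duality_map_dif[OF fin p gauge] by simp
  qed
qed

end
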